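(* Let $d\ge 2$ be even, let $Q$ be a real symmetric positive definite $n\times n$ matrix, and let $L$ be the moment functional $L(g)=\int_{\mathbb{S}^{n-1}}g(\mathbf{z})\,\mathrm{d}\nu(\mathbf{z})$ on real $n$-variate forms $g$ of degree $d$, where the measure $\nu$ on the unit sphere $\mathbb{S}^{n-1}$ is defined by $$\mathrm{d}\nu(\mathbf{z})=\binom{d/2+n-1}{n-1}\frac{\sqrt{\det(Q)}}{\sqrt{\mathbf{z}^{\mathsf T}Q\mathbf{z}}^{\,d+n}}\,\frac{\mathrm{d}\mathbb{S}^{n-1}(\mathbf{z})}{\mathrm{vol}(\mathbb{S}^{n-1})},\qquad \mathbf{z}\in\mathbb{S}^{n-1}.$$ Then $\mathbf{M}_d(L)^{-1}$ is a Gram matrix of the sum of squares form $(\mathbf{x}^{\mathsf T}Q\mathbf{x})^{d/2}$, that is, $$\mathbf{m}_{d/2}(\mathbf{x})^{\mathsf T}\,\mathbf{M}_d(L)^{-1}\,\mathbf{m}_{d/2}(\mathbf{x})=(\mathbf{x}^{\mathsf T}Q\mathbf{x})^{d/2}.$$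
   Context: $n$ is a positive integer. $\mathrm{d}\mathbb{S}^{n-1}$ is the standard Riemannian measure on the Euclidean unit sphere $\mathbb{S}^{n-1}\subset\mathbb{R}^n$, with total volume $\mathrm{vol}(\mathbb{S}^{n-1})=2\sqrt{\pi}^{\,n}/\Gamma(n/2)$. $\mathbf{m}_{d/2}(\mathbf{x})=(\mathbf{x}^{\alpha})_{|\alpha|=d/2}$ is the column vector of all monomials of degree $d/2$ in $n$ variables (in a fixed order), of length $M=\binom{d/2+n-1}{n-1}$. For a linear functional $L$ on forms of degree $d$, $\mathbf{M}_d(L)=\left(L(\mathbf{y}^{\alpha+\beta})\right)_{|\alpha|=|\beta|=d/2}$ is the associated $M\times M$ matrix. A Gram matrix of a sum of squares form $g$ of degree $d$ is a positive semi-definite real symmetric $M\times M$ matrix $G$ with $g(\mathbf{x})=\mathbf{m}_{d/2}(\mathbf{x})^{\mathsf T}G\,\mathbf{m}_{d/2}(\mathbf{x})$. *)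

theory Defs
  imports "HOL-Analysis.Analysis" "Jordan_Normal_Form.Matrix"
begin

(* Both matrix libraries are used: Q and the points of Euclidean space live in HOL-Analysis, while
   the matrices indexed by monomials, whose size depends on the degree, are those of
   Jordan_Normal_Form.  The infix syntax below is kept for HOL-Analysis only. *)
no_notation scalar_prod (infix "\<bullet>" 70)
no_notation vec_index (infixl "$" 100)

section \<open>Surface measure of the unit sphere\<close>

text \<open>
  The Riemannian measure of the unit sphere in polar-coordinate form: the measure of a Borel set
  \<open>A\<close> is the dimension of the ambient space times the Lebesgue measure of the cone
  \<open>{t x | 0 < t \<le> 1, x \<in> A}\<close>, see \<open>emeasure_sphere_measure\<close>.  Here \<open>sgn x = x /\<^sub>R norm x\<close>.
  It has the total mass \<open>2 sqrt \<pi> ^ n / \<Gamma> (n / 2)\<close> and is invariant under orthogonal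
  transformations, and the Riemannian measure is the only Borel measure with these two properties.
  Invariance is stated for well-ordered index types only because the change of variables theorems
  of HOL-Analysis are.
\<close>

definition sphere_measure :: "'a::euclidean_space measure" where
  "sphere_measure = scale_measure (of_nat DIM('a))
     (distr (restrict_space lborel (cball 0 1 - {0})) (restrict_space borel (sphere 0 1)) sgn)"

lemma sets_sphere_measure [measurable_cong]:
  "sets (sphere_measure :: 'a::euclidean_space measure) = sets (restrict_space borel (sphere 0 1))"
  by (simp add: sphere_measure_def)

lemma space_sphere_measure: "space (sphere_measure :: 'a::euclidean_space measure) = sphere 0 1"
  using sets_eq_imp_space_eq[OF sets_sphere_measure] by (simp add: space_restrict_space)

lemma emeasure_sphere_measure_vimage:
  fixes A :: "'a::euclidean_space set"
  assumes "A \<in> sets borel" "A \<subseteq> sphere 0 1"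
  shows "emeasure sphere_measure A =
    of_nat DIM('a) * emeasure lborel {x \<in> cball 0 1 - {0}. sgn x \<in> A}"
proof -
  let ?B = "cball 0 1 - {0 :: 'a}"
  have A: "A \<in> sets (restrict_space borel (sphere 0 1))"
    using assms by (auto simp: sets_restrict_space_iff)
  have "continuous_on ?B (sgn :: 'a \<Rightarrow> 'a)"
    unfolding sgn_div_norm by (intro continuous_intros) auto
  then have "sgn \<in> measurable (restrict_space lborel ?B) (borel :: 'a measure)"
    by (subst measurable_cong_sets[OF sets_restrict_space_cong[OF sets_lborel] refl])
      (rule borel_measurable_continuous_on_restrict)
  then have m: "sgn \<in> measurable (restrict_space lborel ?B) (restrict_space borel (sphere (0 :: 'a) 1))"
    by (intro measurable_restrict_space2) (auto simp: space_restrict_space norm_sgn)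
  have "emeasure sphere_measure A =
    of_nat DIM('a) * emeasure (restrict_space lborel ?B) (sgn -` A \<inter> ?B)"
    unfolding sphere_measure_def using emeasure_distr[OF m A]
    by (simp add: space_restrict_space)
  also have "emeasure (restrict_space lborel ?B) (sgn -` A \<inter> ?B) = emeasure lborel (sgn -` A \<inter> ?B)"
    by (rule emeasure_restrict_space) auto
  also have "sgn -` A \<inter> ?B = {x \<in> ?B. sgn x \<in> A}" by auto
  finally show ?thesis .
qed

lemma emeasure_sphere_measure:
  fixes A :: "'a::euclidean_space set"
  assumes "A \<in> sets borel" "A \<subseteq> sphere 0 1"
  shows "emeasure sphere_measure A =
    of_nat DIM('a) * emeasure lborel {t *\<^sub>R x | t x. 0 < t \<and> t \<le> 1 \<and> x \<in> A}"
proof -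
  have "{x \<in> cball 0 1 - {0}. sgn x \<in> A} = {t *\<^sub>R x | t x. 0 < t \<and> t \<le> 1 \<and> x \<in> A}" (is "?L = ?R")
  proof
    show "?L \<subseteq> ?R"
    proof
      fix x assume "x \<in> ?L"
      then show "x \<in> ?R"
        by (auto intro!: exI[of _ "norm x"] exI[of _ "sgn x"] simp: sgn_div_norm)
    qed
    show "?R \<subseteq> ?L"
    proof
      fix y assume "y \<in> ?R"
      then obtain t x where "y = t *\<^sub>R x" "0 < t" "t \<le> 1" "x \<in> A" by blast
      moreover from \<open>x \<in> A\<close> assms have "norm x = 1" by auto
      ultimately show "y \<in> ?L" by (auto simp: sgn_div_norm)
    qed
  qed
  with emeasure_sphere_measure_vimage[OF assms] show ?thesis by simp
qed

lemma measure_sphere_measure_total: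
  "measure sphere_measure (sphere (0 :: 'a::euclidean_space) 1) =
     2 * sqrt pi ^ DIM('a) / Gamma (real DIM('a) / 2)"
proof -
  let ?n = "real DIM('a)"
  have *: "{x \<in> cball 0 1 - {0}. sgn x \<in> sphere (0 :: 'a) 1} = cball 0 1 - {0}"
    by (auto simp: norm_sgn)
  have "emeasure lborel (cball 0 1 - {0 :: 'a}) = emeasure lborel (cball (0 :: 'a) 1)"
    by (rule emeasure_Diff_null_set) auto
  then have "emeasure sphere_measure (sphere (0 :: 'a) 1) = ennreal (?n * unit_ball_vol ?n)"
    using emeasure_sphere_measure_vimage[of "sphere (0 :: 'a) 1"] emeasure_cball[of 1 "0 :: 'a"]
    unfolding * by (simp add: ennreal_mult' ennreal_of_nat_eq_real_of_nat)
  then have "measure sphere_measure (sphere (0 :: 'a) 1) = ?n * unit_ball_vol ?n"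
    by (simp add: measure_def)
  also have "\<dots> = ?n * (pi powr (?n / 2) / (?n / 2 * Gamma (?n / 2)))"
  proof -
    have "?n / 2 \<notin> \<int>\<^sub>\<le>\<^sub>0" using nonpos_Ints_nonpos[of "?n / 2"] by force
    from Gamma_plus1[OF this] show ?thesis by (simp only: unit_ball_vol_def add.commute)
  qed
  also have "pi powr (?n / 2) = sqrt pi ^ DIM('a)"
  proof -
    have "sqrt pi ^ DIM('a) = sqrt pi powr ?n" by (rule powr_realpow[symmetric]) simp
    also have "\<dots> = (pi powr (1 / 2)) powr ?n" by (subst powr_half_sqrt) auto
    also have "\<dots> = pi powr (?n / 2)" by (simp add: powr_powr)
    finally show ?thesis ..
  qed
  finally show ?thesis by simp
qed

lemma emeasure_sphere_measure_orthogonal: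
  fixes f :: "real ^ 'n::{finite,wellorder} \<Rightarrow> real ^ 'n::_"
  assumes f: "orthogonal_transformation f" and A: "A \<in> sets borel" "A \<subseteq> sphere 0 1"
  shows "emeasure sphere_measure (f ` A) = emeasure sphere_measure A"
proof -
  obtain g where g: "orthogonal_transformation g" "\<And>x. g (f x) = x" "\<And>x. f (g x) = x"
    using orthogonal_transformation_inv[OF f] orthogonal_transformation_bij[OF f]
    by (metis bij_inv_eq_iff)
  have img: "f ` S = {x. g x \<in> S}" for S 
    by (auto simp: g image_iff intro!: bexI[where x = "g _"])
  have gm: "g \<in> borel_measurable borel"
    using g(1) by (intro borel_measurable_continuous_onI linear_continuous_on)
      (simp add: linear_linear orthogonal_transformation_linear)
  have fA: "f ` A \<in> sets borel" unfolding img using measurable_sets[OF gm A(1)]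
    by (simp add: vimage_def)
  have fA': "f ` A \<subseteq> sphere 0 1"
    using A(2) orthogonal_transformation_norm[OF f] by auto
  define S where "S = {x \<in> cball 0 1 - {0}. sgn x \<in> A}"
  have "sgn \<in> borel_measurable (borel :: (real ^ 'n::_) measure)"
    unfolding sgn_div_norm by measurable
  from measurable_sets[OF this A(1)] have "sgn -` A \<inter> (cball 0 1 - {0}) \<in> sets borel" by simp
  also have "sgn -` A \<inter> (cball 0 1 - {0}) = S" by (auto simp: S_def)
  finally have S: "S \<in> sets borel" .
  have fS: "f ` S \<in> sets borel"
    unfolding img using measurable_sets[OF gm S] by (simp add: vimage_def)
  have "linear f" using f by (rule orthogonal_transformation_linear)
  then have "f (t *\<^sub>R x) = t *\<^sub>R f x" for t x by (rule linear_cmul)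
  then have sgn_f: "sgn (f x) = f (sgn x)" for x
    by (simp add: sgn_div_norm orthogonal_transformation_norm[OF f])
  have g_simps: "g x = 0 \<longleftrightarrow> x = 0" "norm (g x) = norm x" "sgn (g x) = g (sgn x)" for x
  proof -
    show n: "norm (g x) = norm x" by (rule orthogonal_transformation_norm[OF g(1)])
    show "g x = 0 \<longleftrightarrow> x = 0" using n by (metis norm_eq_zero)
    have "g (sgn x) = g (sgn (f (g x)))" by (simp only: g(3))
    also have "\<dots> = sgn (g x)" by (simp only: sgn_f g(2))
    finally show "sgn (g x) = g (sgn x)" ..
  qed
  have fS_eq: "{x \<in> cball 0 1 - {0}. sgn x \<in> f ` A} = f ` S"
    unfolding img by (auto simp: S_def g_simps)
  have "bounded S" by (rule bounded_subset[of "cball 0 1"]) (auto simp: S_def)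
  then have "S \<in> lmeasurable" using S by (intro bounded_set_imp_lmeasurable) auto
  with f have "f ` S \<in> lmeasurable" "measure lebesgue (f ` S) = measure lebesgue S"
    by (auto intro: measurable_orthogonal_image measure_orthogonal_image)
  then have "emeasure lebesgue (f ` S) = emeasure lebesgue S"
    using \<open>S \<in> lmeasurable\<close> by (simp add: emeasure_eq_measure2)
  then have eq: "emeasure lborel (f ` S) = emeasure lborel S" using S fS by simp
  show ?thesis
    unfolding emeasure_sphere_measure_vimage[OF A] emeasure_sphere_measure_vimage[OF fA fA'] fS_eq eq
    unfolding S_def ..
qed

section \<open>Forms and monomials\<close>

text \<open>
  Real polynomials in \<open>n = CARD('n)\<close> variables are identified with polynomial functions on
  \<open>real ^ 'n\<close> (the reals are infinite, so nothing is lost), and exponent vectors are functions \<open>'n \<Rightarrow> nat\<close>.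
\<close>

definition exponents :: "nat \<Rightarrow> ('n::finite \<Rightarrow> nat) set" where
  "exponents k = {\<alpha>. (\<Sum>i\<in>UNIV. \<alpha> i) = k}"

definition monomial :: "('n::finite \<Rightarrow> nat) \<Rightarrow> real ^ 'n \<Rightarrow> real" where
  "monomial \<alpha> x = (\<Prod>i\<in>UNIV. (x $ i) ^ \<alpha> i)"

definition form :: "nat \<Rightarrow> (real ^ 'n \<Rightarrow> real) \<Rightarrow> bool" where
  "form k g \<longleftrightarrow> (\<exists>c. \<forall>x. g x = (\<Sum>\<alpha>\<in>exponents k. c \<alpha> * monomial \<alpha> x))"

definition sos_form :: "nat \<Rightarrow> (real ^ 'n \<Rightarrow> real) \<Rightarrow> bool" where
  "sos_form d g \<longleftrightarrow> form d g \<and>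
     (\<exists>(q :: nat \<Rightarrow> real ^ 'n \<Rightarrow> real) r. (\<forall>i<r. form (d div 2) (q i)) \<and> (\<forall>x. g x = (\<Sum>i<r. (q i x)\<^sup>2)))"

text \<open>An enumeration of the exponents of degree \<open>k\<close> fixes the order of the monomials.\<close>

definition exponent_order :: "nat \<Rightarrow> ('n::finite \<Rightarrow> nat) list \<Rightarrow> bool" where
  "exponent_order k es \<longleftrightarrow> distinct es \<and> set es = exponents k"

lemma finite_exponents: "finite (exponents k :: ('n::finite \<Rightarrow> nat) set)"
proof (rule finite_subset)
  show "exponents k \<subseteq> (\<Pi>\<^sub>E i\<in>(UNIV :: 'n set). {..k})"
  proof
    fix \<alpha> :: "'n \<Rightarrow> nat" assume "\<alpha> \<in> exponents k"
    then have "\<alpha> i \<le> k" for i using member_le_sum[of i UNIV \<alpha>] by (simp add: exponents_def)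
    then show "\<alpha> \<in> (\<Pi>\<^sub>E i\<in>UNIV. {..k})" by auto
  qed
qed (auto intro: finite_PiE)

lemma exponent_order_exists: "\<exists>es. exponent_order k es"
  unfolding exponent_order_def using finite_distinct_list[OF finite_exponents] by blast

definition monomial_vec :: "('n::finite \<Rightarrow> nat) list \<Rightarrow> real ^ 'n \<Rightarrow> real Matrix.vec" where
  "monomial_vec es x = Matrix.vec (length es) (\<lambda>i. monomial (es ! i) x)"

section \<open>Moment and Gram matrices\<close>

definition moment_mat ::
  "('n::finite \<Rightarrow> nat) list \<Rightarrow> ((real ^ 'n \<Rightarrow> real) \<Rightarrow> real) \<Rightarrow> real Matrix.mat" where
  "moment_mat es L = Matrix.mat (length es) (length es)
     (\<lambda>(i, j). L (monomial (\<lambda>k. (es ! i) k + (es ! j) k)))"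

definition psd_mat :: "nat \<Rightarrow> real Matrix.mat \<Rightarrow> bool" where
  "psd_mat m G \<longleftrightarrow> G \<in> carrier_mat m m \<and> transpose_mat G = G \<and>
     (\<forall>v\<in>carrier_vec m. 0 \<le> scalar_prod v (mult_mat_vec G v))"

definition gram_mat ::
  "nat \<Rightarrow> ('n::finite \<Rightarrow> nat) list \<Rightarrow> (real ^ 'n \<Rightarrow> real) \<Rightarrow> real Matrix.mat \<Rightarrow> bool" where
  "gram_mat d es g G \<longleftrightarrow> sos_form d g \<and> psd_mat (length es) G \<and>
     (\<forall>x. g x = scalar_prod (monomial_vec es x) (mult_mat_vec G (monomial_vec es x)))"

section \<open>The measure and its moment functional\<close>

definition pos_def :: "real ^ 'n ^ 'n \<Rightarrow> bool" where
  "pos_def Q \<longleftrightarrow> Finite_Cartesian_Product.transpose Q = Q \<and> (\<forall>x. x \<noteq> 0 \<longrightarrow> 0 < x \<bullet> (Q *v x))"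

definition nu :: "nat \<Rightarrow> real ^ 'n ^ 'n \<Rightarrow> (real ^ 'n) measure" where
  "nu d Q = density sphere_measure (\<lambda>z. ennreal (
     real ((d div 2 + CARD('n) - 1) choose (CARD('n) - 1)) *
     (sqrt (Determinants.det Q) / sqrt (z \<bullet> (Q *v z)) ^ (d + CARD('n))) /
     measure sphere_measure (sphere (0 :: real ^ 'n) 1)))"

definition moment_functional :: "nat \<Rightarrow> real ^ 'n ^ 'n \<Rightarrow> (real ^ 'n \<Rightarrow> real) \<Rightarrow> real" where
  "moment_functional d Q g = (LINT z|nu d Q. g z)"

end

theory Submission
  imports Defs "Jordan_Normal_Form.Determinant"
begin

(* Determinant brings the infix syntax removed in Defs back. *)
no_notation scalar_prod (infix "\<bullet>" 70)
no_notation vec_index (infixl "$" 100)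

text \<open>
  Let \<open>P\<^sup>T Q P = 1\<close> and \<open>q(x) = x\<^sup>T Q x\<close>, \<open>k = d/2\<close>.  Substituting \<open>z = P y / |P y|\<close> turns \<open>L(g)\<close> into
  the number \<open>N\<close> of monomials of degree \<open>k\<close> times the mean of \<open>g(P y)\<close> over the unit sphere.  The
  function \<open>K(x, y) = m(x)\<^sup>T M\<^sup>-\<^sup>1 m(y)\<close> is the reproducing kernel of the forms of degree \<open>k\<close> with the
  inner product \<open>L(f g)\<close>.  As \<open>P\<close> may be replaced by \<open>P U\<close> with \<open>U\<close> orthogonal, \<open>L\<close> is invariant under
  \<open>P U P\<^sup>-\<^sup>1\<close>, hence so is \<open>K\<close>; these maps act transitively on \<open>q(x) = 1\<close>, so \<open>K(x, x) = c q(x)\<^sup>k\<close>.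
  Applying \<open>L\<close> gives \<open>N = tr (M\<^sup>-\<^sup>1 M) = c L(q\<^sup>k) = c N\<close>, so \<open>c = 1\<close>.
\<close>

section \<open>Linear maps and Lebesgue measure\<close>

text \<open>Let n be the number of variables. The exponent d + n of the density splits in two. The
  power n, together with sqrt(det Q), gives the normalised cone measure of the ellipsoid q = 1,
  projected radially to the sphere; this part of the weight alone turns the surface measure into the
  image of the uniform distribution under y \<mapsto> P y / |P y|. The power d corrects for the
  normalisation: for |y| = 1 the point P y / |P y| has q = 1 / |P y|^2 and g takes the value g(P y)
  / |P y|^d there, so dividing by sqrt(q)^d leaves g(P y). Since the surface measure is given by
  volumes of cones in the unit ball, the density is found in solid form: the volume of a cone cut
  off at q <= 1 is a weighted integral over its part in the unit ball, and the linear map P relates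
  it to a subset of the ball. Invertibility of M comes from L(f^2) > 0 for nonzero forms f of degree
  k, combined with the linear independence of the monomials.\<close>

lemma measure_linear_image_cart:
  fixes f :: "real^'n \<Rightarrow> real^'n"
  assumes "linear f" "S \<in> lmeasurable"
  shows "f ` S \<in> lmeasurable \<and>
    measure lebesgue (f ` S) = \<bar>Determinants.det (matrix f)\<bar> * measure lebesgue S"
proof -
  let ?P = "\<lambda>f :: real^'n \<Rightarrow> real^'n. \<forall>S\<in>lmeasurable. f ` S \<in> lmeasurable \<and>
    measure lebesgue (f ` S) = \<bar>Determinants.det (matrix f)\<bar> * measure lebesgue S"
  \<comment> \<open>For swaps and shears it is enough that boxes keep their volume. The factor
    \<open>1\<close> is written out to fit the scale factor of
    \<open>measure_linear_sufficient\<close>.\<close>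
  have boxes: "?P h" if "linear h" "\<bar>Determinants.det (matrix h)\<bar> = 1"
    "\<And>a b. cbox a b \<noteq> {} \<Longrightarrow> measure lebesgue (h ` cbox a b) = measure lebesgue (cbox a b)"
    for h :: "real^'n \<Rightarrow> real^'n"
  proof -
    have im: "measure lebesgue (h ` cbox a b) = 1 * measure lebesgue (cbox a b)" for a b
    proof (cases "cbox a b = {}")
      case False
      from that(3)[OF this] show ?thesis by (simp only: mult_1)
    qed simp
    have "h ` S \<in> lmeasurable \<and> measure lebesgue (h ` S) = 1 * measure lebesgue S"
      if "S \<in> lmeasurable" for S
      using measure_linear_sufficient[OF \<open>linear h\<close> that im] by (simp only: mult_1 simp_thms)
    then show ?thesis unfolding that(2) by (intro ballI)
  qed
  have "?P f"
  \<comment> \<open>The cases are compositions, maps with a vanishing coordinate, stretches, swaps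
    of two coordinates and the addition of one coordinate to another.\<close>
  proof (rule induct_linear_elementary[OF assms(1)])
    fix f g :: "real^'n \<Rightarrow> real^'n"
    assume "linear f" "linear g" "?P f" "?P g"
    show "?P (f \<circ> g)"
    proof
      fix S :: "(real^'n) set" assume "S \<in> lmeasurable"
      with \<open>?P f\<close> \<open>?P g\<close> have "f ` g ` S \<in> lmeasurable \<and> measure lebesgue (f ` g ` S) =
        \<bar>Determinants.det (matrix f)\<bar> * (\<bar>Determinants.det (matrix g)\<bar> * measure lebesgue S)"
        by simp
      then show "(f \<circ> g) ` S \<in> lmeasurable \<and> measure lebesgue ((f \<circ> g) ` S) =
        \<bar>Determinants.det (matrix (f \<circ> g))\<bar> * measure lebesgue S"
        unfolding image_comp matrix_compose[OF \<open>linear g\<close> \<open>linear f\<close>] det_mul abs_mult mult.assoc .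
    qed
  next
    fix f :: "real^'n \<Rightarrow> real^'n" and i
    assume f: "linear f" "\<And>x. f x $ i = 0"
    then have "\<not> surj f" by (metis one_neq_zero surjE vec_component)
    then have ni: "\<not> inj f" using f(1) linear_injective_imp_surjective by blast
    then have "negligible (f ` S)" for S using f(1) negligible_linear_singular_image by blast
    moreover have "Determinants.det (matrix f) = 0" using ni f(1) det_nz_iff_inj by blast
    ultimately show "?P f" by (simp add: negligible_iff_measure)
  next
    fix c :: "'n \<Rightarrow> real"
    have "matrix (\<lambda>x. \<chi> i. c i * x $ i) = (\<chi> i j. if i = j then c i else 0)"
      by (simp add: matrix_def axis_def Finite_Cartesian_Product.vec_eq_iff)
    then have "Determinants.det (matrix (\<lambda>x. \<chi> i. c i * x $ i)) = prod c UNIV"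
      by (simp add: det_diagonal)
    then show "?P (\<lambda>x. \<chi> i. c i * x $ i)"
      by (auto simp: measurable_stretch measure_stretch)
  next
    fix m n :: 'n assume "m \<noteq> n"
    let ?s = "Transposition.transpose m n"
    let ?h = "\<lambda>x :: real^'n. \<chi> i. x $ ?s i"
    show "?P ?h"
    proof (rule boxes)
      show "linear ?h" by (rule linearI) (simp_all add: Finite_Cartesian_Product.vec_eq_iff)
      have "matrix ?h = (\<chi> i. Finite_Cartesian_Product.mat 1 $ ?s i)"
        by (auto simp: Finite_Cartesian_Product.vec_eq_iff matrix_def axis_def Finite_Cartesian_Product.mat_def)
      then show "\<bar>Determinants.det (matrix ?h)\<bar> = 1"
        by (simp add: Determinants.det_permute_rows permutes_swap_id sign_swap_id)
      fix a b :: "real^'n" assume ne: "cbox a b \<noteq> {}"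
      have hh: "?h (?h x) = x" for x by (simp add: Finite_Cartesian_Product.vec_eq_iff)
      \<comment> \<open>Reindexing by the involution \<open>?s\<close>, for a general relation so
        that both bounds of a box are moved at once.\<close>
      have R: "(\<forall>i. R (?s i) i) \<longleftrightarrow> (\<forall>i. R i (?s i))" for R
        by (metis transpose_involutory)
      have h_cbox: "?h x \<in> cbox a b \<longleftrightarrow> x \<in> cbox (?h a) (?h b)" for x
        unfolding mem_box_cart vec_lambda_beta
        by (rule R[of "\<lambda>j i. a $ j \<le> x $ i \<and> x $ i \<le> b $ j", symmetric])
      have eq: "?h ` cbox a b = cbox (?h a) (?h b)"
      proof (intro equalityI subsetI)
        fix x assume "x \<in> ?h ` cbox a b"
        then obtain y where y: "y \<in> cbox a b" "x = ?h y" by (rule imageE)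
        then show "x \<in> cbox (?h a) (?h b)" by (simp only: h_cbox[symmetric] hh)
      next
        fix x assume "x \<in> cbox (?h a) (?h b)"
        then have "?h x \<in> cbox a b" by (simp only: h_cbox)
        then have "?h (?h x) \<in> ?h ` cbox a b" by (rule imageI)
        then show "x \<in> ?h ` cbox a b" by (simp only: hh)
      qed
      have ne': "cbox (?h a) (?h b) \<noteq> {}" using ne by (simp flip: eq)
      have "(\<Prod>i\<in>UNIV. b $ i - a $ i) = (\<Prod>i\<in>UNIV. b $ ?s i - a $ ?s i)"
        using prod.permute[of ?s UNIV "\<lambda>i. b $ i - a $ i"]
        by (simp add: permutes_swap_id o_def)
      then show "measure lebesgue (?h ` cbox a b) = measure lebesgue (cbox a b)"
        using ne ne' by (simp add: eq content_cbox_cart)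
    qed
  next
    fix m n :: 'n assume mn: "m \<noteq> n"
    let ?h = "\<lambda>x :: real^'n. \<chi> i. if i = m then x $ m + x $ n else x $ i"
    have lin: "linear ?h" by (rule linearI) (simp_all add: Finite_Cartesian_Product.vec_eq_iff algebra_simps)
    show "?P ?h"
    proof (rule boxes)
      show "linear ?h" by fact
      have "matrix ?h = (\<chi> i. if i = m then Finite_Cartesian_Product.row m (Finite_Cartesian_Product.mat 1) + 1 *s Finite_Cartesian_Product.row n (Finite_Cartesian_Product.mat 1) else Finite_Cartesian_Product.row i (Finite_Cartesian_Product.mat 1))"
        using mn by (auto simp: Finite_Cartesian_Product.vec_eq_iff matrix_def axis_def Finite_Cartesian_Product.mat_def Finite_Cartesian_Product.row_def)
      then show "\<bar>Determinants.det (matrix ?h)\<bar> = 1"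
        using det_row_operation[OF mn, of "Finite_Cartesian_Product.mat 1 :: real^'n^'n" 1] by simp
      fix a b :: "real^'n" assume ne: "cbox a b \<noteq> {}"
      \<comment> \<open>The library computes the volume of a sheared box only for a nonnegative corner.\<close>
      let ?t = "\<chi> i. if i = n then - (a $ n) else 0"
      have box: "cbox (?t + a) (?t + b) = (+) ?t ` cbox a b" by (rule cbox_translation)
      have "measure lebesgue (?h ` cbox a b) = measure lebesgue ((+) (?h ?t) ` ?h ` cbox a b)"
        by (rule measure_translation[symmetric])
      also have "(+) (?h ?t) ` ?h ` cbox a b = ?h ` (+) ?t ` cbox a b"
        by (simp only: image_image linear_add[OF lin])
      also have "measure lebesgue (?h ` (+) ?t ` cbox a b) = measure lebesgue ((+) ?t ` cbox a b)"
        unfolding box[symmetric]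
        by (rule measure_shear_interval) (use mn ne in \<open>auto simp: box\<close>)
      also have "\<dots> = measure lebesgue (cbox a b)" by (rule measure_translation)
      finally show "measure lebesgue (?h ` cbox a b) = measure lebesgue (cbox a b)" .
    qed
  qed
  with assms(2) show ?thesis by blast
qed

section \<open>Integrals over sectors and over the sphere\<close>

lemma nn_integral_lborel_scale:
  fixes h :: "'a::euclidean_space \<Rightarrow> ennreal"
  assumes [measurable]: "h \<in> borel_measurable borel" and "c \<noteq> 0"
  shows "(\<integral>\<^sup>+x. h x \<partial>lborel) = (\<integral>\<^sup>+x. ennreal (\<bar>c\<bar> ^ DIM('a)) * h (c *\<^sub>R x) \<partial>lborel)"
  by (subst lborel_affine[OF assms(2), where t = 0])
    (simp add: nn_integral_density nn_integral_distr)

text \<open>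
  Insert \<open>1 = \<integral> norm x dt\<close> over \<open>0 < t \<le> 1 / norm x\<close>, exchange the integrals and substitute \<open>x = y / t\<close>.
\<close>

lemma sector_nn_integral:
  fixes \<rho> :: "'a::euclidean_space \<Rightarrow> real" and u :: "'a \<Rightarrow> ennreal"
  assumes [measurable]: "\<rho> \<in> borel_measurable borel" "u \<in> borel_measurable borel"
    and \<rho>_pos: "\<And>x. x \<noteq> 0 \<Longrightarrow> 0 < \<rho> x" and \<rho>_hom: "\<And>t x. 0 < t \<Longrightarrow> \<rho> (t *\<^sub>R x) = t * \<rho> x"
    and u_0: "u 0 = 0" and u_hom: "\<And>t x. 0 < t \<Longrightarrow> u (t *\<^sub>R x) = u x"
  shows "of_nat DIM('a) * (\<integral>\<^sup>+x. u x * indicator {x. \<rho> x \<le> 1} x \<partial>lborel) =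
    (\<integral>\<^sup>+x. u x * indicator (cball 0 1) x * ennreal (norm x / \<rho> x ^ DIM('a)) \<partial>lborel)"
proof -
  let ?n = "DIM('a)"
  define F :: "'a \<Rightarrow> real \<Rightarrow> ennreal" where "F x t =
    u x * indicator {x. \<rho> x \<le> 1} x * (ennreal (norm x) * indicator {t. 0 < t \<and> t * norm x \<le> 1} t)" for x t
  \<comment> \<open>This is \<open>F\<close> after x = y / t: the Jacobian t^-n and norm x = norm y
    / t give 1 / t^(n+1), the condition \<rho> x <= 1 becomes \<rho> y <= t, and t * norm x <= 1
    says that y is in the unit ball.\<close>
  define H :: "'a \<Rightarrow> real \<Rightarrow> ennreal" where "H y t =
    u y * indicator (cball 0 1) y * ennreal (norm y) * (ennreal (1 / t ^ Suc ?n) * indicator {\<rho> y..} t)" for y t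
  have [measurable]: "Measurable.pred (borel \<Otimes>\<^sub>M borel) (\<lambda>(x, t :: real). 0 < t \<and> t * norm (x :: 'a) \<le> 1)"
    by measurable
  have F_meas: "case_prod F \<in> borel_measurable (lborel \<Otimes>\<^sub>M lborel)"
  proof -
    have "case_prod F \<in> borel_measurable (borel \<Otimes>\<^sub>M borel)"
      unfolding F_def indicator_def mem_Collect_eq by measurable
    then show ?thesis
      by (subst measurable_cong_sets[OF sets_pair_measure_cong[OF sets_lborel sets_lborel] refl])
  qed
  have H_meas: "case_prod H \<in> borel_measurable (lborel \<Otimes>\<^sub>M lborel)"
  proof -
    have "case_prod H \<in> borel_measurable (borel \<Otimes>\<^sub>M borel)"
      unfolding H_def indicator_def mem_cball_0 atLeast_iff by measurable
    then show ?thesis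
      by (subst measurable_cong_sets[OF sets_pair_measure_cong[OF sets_lborel sets_lborel] refl])
  qed
  have F_int: "(\<integral>\<^sup>+t. F x t \<partial>lborel) = u x * indicator {x. \<rho> x \<le> 1} x" for x
  proof (cases "x = 0")
    case False
    then have "{t. 0 < t \<and> t * norm x \<le> 1} = {0<..1 / norm x}" by (auto simp: field_simps)
    then have "(\<integral>\<^sup>+t. ennreal (norm x) * indicator {t. 0 < t \<and> t * norm x \<le> 1} t \<partial>lborel) = 1"
      using False by (simp add: nn_integral_cmult_indicator flip: ennreal_mult')
    then show ?thesis unfolding F_def by (subst nn_integral_cmult) auto
  qed (simp add: F_def u_0)
  have FH: "(\<integral>\<^sup>+x. F x t \<partial>lborel) = (\<integral>\<^sup>+y. H y t \<partial>lborel)" for t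
  proof (cases "0 < t")
    case True
    have [measurable]: "(\<lambda>x. F x t) \<in> borel_measurable borel" unfolding F_def by measurable
    have "ennreal (\<bar>1 / t\<bar> ^ ?n) * F ((1 / t) *\<^sub>R y) t = H y t" for y
    proof (cases "y = 0")
      case False
      have "ennreal (1 / t ^ ?n) * ennreal (norm y / t) = ennreal (norm y) * ennreal (1 / t ^ Suc ?n)"
        using True by (simp flip: ennreal_mult')
      then show ?thesis
        using True u_hom[of "1 / t" y]
        by (auto simp: F_def H_def indicator_def \<rho>_hom field_simps abs_of_pos)
    qed (use u_0 in \<open>simp add: F_def H_def\<close>)
    then show ?thesis using nn_integral_lborel_scale[of "\<lambda>x. F x t" "1 / t"] True by simp
  next
    case False
    then have "F x t = 0" for x by (simp add: F_def)
    moreover have "H y t = 0" for y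
    proof (cases "y = 0")
      case y: False
      then show ?thesis using False \<rho>_pos[OF y] by (simp add: H_def)
    qed (simp add: H_def u_0)
    ultimately show ?thesis by simp
  qed
  \<comment> \<open>The integral of n / t^(n+1) over t >= \<rho> y is 1 / \<rho>(y)^n; this absorbs
    the dimension factor of the claim.\<close>
  have H_int: "of_nat ?n * (\<integral>\<^sup>+t. H y t \<partial>lborel) =
    u y * indicator (cball 0 1) y * ennreal (norm y / \<rho> y ^ ?n)" for y
  proof (cases "y = 0")
    case False
    define a where "a = \<rho> y"
    have a: "0 < a" using \<rho>_pos[OF False] by (simp add: a_def)
    have n: "0 < ?n" by simp
    have lim: "((\<lambda>t. - (1 / (real ?n * t ^ ?n))) \<longlongrightarrow> 0) at_top"
      using n by real_asymp
    have der: "((\<lambda>t. - (1 / (real ?n * t ^ ?n))) has_real_derivative 1 / t ^ Suc ?n) (at t)" if "a \<le> t" for t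
    proof -
      from a that have t: "t > 0" by linarith
      obtain m where m: "?n = Suc m" using n by (cases ?n) auto
      have "((\<lambda>t. t ^ Suc m) has_real_derivative real (Suc m) * t ^ m) (at t)"
        using DERIV_pow[of "Suc m" t] by simp
      from DERIV_cmult[OF DERIV_inverse_fun[OF this], of "- 1 / real (Suc m)"] t
      have "((\<lambda>t. (- 1 / real (Suc m)) * inverse (t ^ Suc m)) has_real_derivative
          (- 1 / real (Suc m)) * - (real (Suc m) * t ^ m * inverse ((t ^ Suc m) ^ Suc (Suc 0)))) (at t)"
        by (simp del: of_nat_Suc power_Suc)
      moreover have "(\<lambda>t. (- 1 / real (Suc m)) * inverse (t ^ Suc m)) = (\<lambda>t. - (1 / (real (Suc m) * t ^ Suc m)))"
        by (simp add: field_simps)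
      moreover have "(- 1 / real (Suc m)) * - (real (Suc m) * t ^ m * inverse ((t ^ Suc m) ^ Suc (Suc 0))) = 1 / t ^ Suc (Suc m)"
        using t by (simp add: field_simps del: of_nat_Suc)
      ultimately show ?thesis unfolding m by (simp only:)
    qed
    have "(\<integral>\<^sup>+t. ennreal (1 / t ^ Suc ?n) * indicator {a..} t \<partial>lborel) = ennreal (0 - - (1 / (real ?n * a ^ ?n)))"
      by (rule nn_integral_FTC_atLeast[OF _ der _ lim]) (use a in auto)
    then have "of_nat ?n * (\<integral>\<^sup>+t. ennreal (1 / t ^ Suc ?n) * indicator {a..} t \<partial>lborel) = ennreal (1 / a ^ ?n)"
      by (simp add: ennreal_of_nat_eq_real_of_nat flip: ennreal_mult')
    moreover have "(\<integral>\<^sup>+t. H y t \<partial>lborel) = u y * indicator (cball 0 1) y * ennreal (norm y) *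
        (\<integral>\<^sup>+t. ennreal (1 / t ^ Suc ?n) * indicator {a..} t \<partial>lborel)"
      unfolding H_def a_def by (subst nn_integral_cmult) auto
    ultimately have "of_nat ?n * (\<integral>\<^sup>+t. H y t \<partial>lborel) =
        u y * indicator (cball 0 1) y * (ennreal (norm y) * ennreal (1 / a ^ ?n))"
      by (simp only: mult.left_commute[of "of_nat _"] mult.assoc)
    also have "ennreal (norm y) * ennreal (1 / a ^ ?n) = ennreal (norm y / a ^ ?n)"
      using a by (simp flip: ennreal_mult')
    finally show ?thesis by (simp add: a_def)
  qed (simp add: H_def u_0)
  have "(\<integral>\<^sup>+x. u x * indicator {x. \<rho> x \<le> 1} x \<partial>lborel) = (\<integral>\<^sup>+x. (\<integral>\<^sup>+t. F x t \<partial>lborel) \<partial>lborel)"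
    by (simp only: F_int)
  also have "\<dots> = (\<integral>\<^sup>+t. (\<integral>\<^sup>+x. F x t \<partial>lborel) \<partial>lborel)"
    by (rule lborel_pair.Fubini'[symmetric]) (fact F_meas)
  also have "\<dots> = (\<integral>\<^sup>+t. (\<integral>\<^sup>+y. H y t \<partial>lborel) \<partial>lborel)" by (simp only: FH)
  also have "\<dots> = (\<integral>\<^sup>+y. (\<integral>\<^sup>+t. H y t \<partial>lborel) \<partial>lborel)"
    by (rule lborel_pair.Fubini') (fact H_meas)
  finally have "of_nat ?n * (\<integral>\<^sup>+x. u x * indicator {x. \<rho> x \<le> 1} x \<partial>lborel) =
      of_nat ?n * (\<integral>\<^sup>+y. (\<integral>\<^sup>+t. H y t \<partial>lborel) \<partial>lborel)" by simp
  also have "\<dots> = (\<integral>\<^sup>+y. of_nat ?n * (\<integral>\<^sup>+t. H y t \<partial>lborel) \<partial>lborel)"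
    using H_meas by (subst nn_integral_cmult) (auto intro!: lborel.borel_measurable_nn_integral)
  finally show ?thesis by (simp only: H_int)
qed

text \<open>Two uses of \<open>sector_nn_integral\<close>: one for \<rho> and \<open>u\<close>, one
  for the norm and \<open>u\<close> times (norm x / \<rho> x)^n, which is again constant along rays.
  Both lead to the same integral over the ball, and the dimension cancels. With \<open>u\<close> the
  indicator of a cone, this expresses the volume of the cone below \<rho> = 1 by an integral over
  the unit ball.\<close>

lemma sector_nn_integral_cball:
  fixes \<rho> :: "'a::euclidean_space \<Rightarrow> real" and u :: "'a \<Rightarrow> ennreal"
  assumes [measurable]: "\<rho> \<in> borel_measurable borel" "u \<in> borel_measurable borel"
    and \<rho>_pos: "\<And>x. x \<noteq> 0 \<Longrightarrow> 0 < \<rho> x" and \<rho>_hom: "\<And>t x. 0 < t \<Longrightarrow> \<rho> (t *\<^sub>R x) = t * \<rho> x"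
    and u_0: "u 0 = 0" and u_hom: "\<And>t x. 0 < t \<Longrightarrow> u (t *\<^sub>R x) = u x"
  shows "(\<integral>\<^sup>+x. u x * indicator {x. \<rho> x \<le> 1} x \<partial>lborel) =
    (\<integral>\<^sup>+x. u x * ennreal ((norm x / \<rho> x) ^ DIM('a)) * indicator (cball 0 1) x \<partial>lborel)"
proof -
  let ?n = "DIM('a)"
  let ?v = "\<lambda>x. u x * ennreal ((norm x / \<rho> x) ^ ?n)"
  have "of_nat ?n * (\<integral>\<^sup>+x. ?v x * indicator {x. norm x \<le> 1} x \<partial>lborel) =
      (\<integral>\<^sup>+x. ?v x * indicator (cball 0 1) x * ennreal (norm x / norm x ^ ?n) \<partial>lborel)"
    by (rule sector_nn_integral) (auto simp: u_0 u_hom \<rho>_hom)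
  also have "\<dots> = (\<integral>\<^sup>+x. u x * indicator (cball 0 1) x * ennreal (norm x / \<rho> x ^ ?n) \<partial>lborel)"
  proof (rule nn_integral_cong)
    fix x :: 'a
    show "?v x * indicator (cball 0 1) x * ennreal (norm x / norm x ^ ?n) =
      u x * indicator (cball 0 1) x * ennreal (norm x / \<rho> x ^ ?n)"
    proof (cases "x = 0")
      case False
      then have "ennreal ((norm x / \<rho> x) ^ ?n) * ennreal (norm x / norm x ^ ?n) = ennreal (norm x / \<rho> x ^ ?n)"
        using \<rho>_pos[OF False] by (simp add: power_divide flip: ennreal_mult')
      moreover have "?v x * indicator (cball 0 1) x * ennreal (norm x / norm x ^ ?n) = u x *
          indicator (cball 0 1) x * (ennreal ((norm x / \<rho> x) ^ ?n) * ennreal (norm x / norm x ^ ?n))"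
        by (simp only: mult.assoc mult.left_commute[of "indicator (cball 0 1) x"])
      ultimately show ?thesis by simp
    qed (simp add: u_0)
  qed
  also have "\<dots> = of_nat ?n * (\<integral>\<^sup>+x. u x * indicator {x. \<rho> x \<le> 1} x \<partial>lborel)"
    by (rule sector_nn_integral[symmetric]) (auto simp: assms)
  finally have "of_nat ?n * (\<integral>\<^sup>+x. ?v x * indicator {x. norm x \<le> 1} x \<partial>lborel) =
      of_nat ?n * (\<integral>\<^sup>+x. u x * indicator {x. \<rho> x \<le> 1} x \<partial>lborel)" .
  then have "(\<integral>\<^sup>+x. ?v x * indicator {x. norm x \<le> 1} x \<partial>lborel) =
      (\<integral>\<^sup>+x. u x * indicator {x. \<rho> x \<le> 1} x \<partial>lborel)"
    by (simp add: ennreal_mult_cancel_left)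
  then show ?thesis by (simp add: cball_def dist_norm)
qed

section \<open>Congruence of a positive definite matrix to the identity\<close>

text \<open>Gram-Schmidt for the inner product x^T Q y: as long as there are fewer vectors than the
  dimension, some \<open>v\<close> lies outside their span, and \<open>v\<close> minus its
  projection can be normalised.\<close>

lemma pos_def_orthonormal_set:
  fixes Q :: "real^'n^'n"
  assumes "pos_def Q" and "m \<le> CARD('n)"
  shows "\<exists>S. finite S \<and> card S = m \<and> (\<forall>x\<in>S. \<forall>y\<in>S. x \<bullet> (Q *v y) = (if x = y then 1 else 0))"
  using assms(2)
proof (induction m)
  case 0
  show ?case by (intro exI[of _ "{}"]) simp
next
  case (Suc m)
  then obtain S where S: "finite S" "card S = m"
    and orth: "\<And>x y. x \<in> S \<Longrightarrow> y \<in> S \<Longrightarrow> x \<bullet> (Q *v y) = (if x = y then 1 else 0)" by fastforce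
  have "Finite_Cartesian_Product.transpose Q = Q" using assms(1) by (simp add: pos_def_def)
  then have sym: "x \<bullet> (Q *v y) = y \<bullet> (Q *v x)" for x y
    by (metis dot_lmul_matrix inner_commute vector_transpose_matrix)
  have pos: "0 < x \<bullet> (Q *v x)" if "x \<noteq> 0" for x using assms(1) that by (simp add: pos_def_def)
  have "dim S < DIM(real^'n)" using dim_le_card'[OF S(1)] S(2) Suc.prems by simp
  then have "span S \<noteq> UNIV" by (metis dim_UNIV dim_span less_irrefl)
  then obtain v where v: "v \<notin> span S" by blast
  define w where "w = v - (\<Sum>x\<in>S. (x \<bullet> (Q *v v)) *\<^sub>R x)"
  have w0: "w \<noteq> 0"
  proof
    assume "w = 0"
    then have "v = (\<Sum>x\<in>S. (x \<bullet> (Q *v v)) *\<^sub>R x)" by (simp add: w_def)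
    also have "\<dots> \<in> span S" by (intro span_sum span_scale span_base)
    finally show False using v by simp
  qed
  have w_orth: "y \<bullet> (Q *v w) = 0" if "y \<in> S" for y
  proof -
    have "y \<bullet> (Q *v w) = y \<bullet> (Q *v v) - (\<Sum>x\<in>S. (x \<bullet> (Q *v v)) * (y \<bullet> (Q *v x)))"
      unfolding w_def
      by (simp add: matrix_vector_mult_diff_distrib inner_diff_right matrix_vector_mult_scaleR inner_sum_right
          linear_sum[OF matrix_vector_mul_linear])
    also have "(\<Sum>x\<in>S. (x \<bullet> (Q *v v)) * (y \<bullet> (Q *v x))) = (\<Sum>x\<in>S. if y = x then x \<bullet> (Q *v v) else 0)"
      by (intro sum.cong refl) (simp add: orth[OF that])
    also have "\<dots> = y \<bullet> (Q *v v)" using S(1) that by simp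
    finally show ?thesis by simp
  qed
  define r where "r = sqrt (w \<bullet> (Q *v w))"
  have r: "r > 0" "r * r = w \<bullet> (Q *v w)" using pos[OF w0] by (simp_all add: r_def)
  let ?u = "(1 / r) *\<^sub>R w"
  have u: "?u \<bullet> (Q *v ?u) = 1" using r(1) by (simp add: matrix_vector_mult_scaleR flip: r(2))
  have u_orth: "y \<bullet> (Q *v ?u) = 0" "?u \<bullet> (Q *v y) = 0" if "y \<in> S" for y
  proof -
    show "y \<bullet> (Q *v ?u) = 0" using w_orth[OF that] by (simp add: matrix_vector_mult_scaleR)
    then show "?u \<bullet> (Q *v y) = 0" using sym by metis
  qed
  have "?u \<notin> S" using u u_orth(1) by (metis zero_neq_one)
  then have "finite (insert ?u S) \<and> card (insert ?u S) = Suc m \<and>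
      (\<forall>x\<in>insert ?u S. \<forall>y\<in>insert ?u S. x \<bullet> (Q *v y) = (if x = y then 1 else 0))"
    using S orth u u_orth by auto
  then show ?case by blast
qed

lemma matrix_entry_inner: "(A :: real^'n^'m) $ i $ j = axis i 1 \<bullet> (A *v axis j 1)"
  by (simp add: matrix_vector_mult_basis inner_axis' column_def)

lemma inner_matrix_vector_mult: "(P *v x) \<bullet> w = x \<bullet> (Finite_Cartesian_Product.transpose P *v w)"
  for P :: "real^'n^'m"
  by (simp only: vector_transpose_matrix[symmetric] dot_lmul_matrix)

text \<open>The columns of \<open>P\<close> are a Q-orthonormal basis, because the entries of P^T Q
  P are the Q-inner products of the columns.\<close>

lemma pos_def_congruent_one:
  fixes Q :: "real^'n^'n"
  assumes "pos_def Q"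
  obtains P :: "real^'n^'n"
  where "Finite_Cartesian_Product.transpose P ** Q ** P = Finite_Cartesian_Product.mat 1"
proof -
  obtain S where S: "finite S" "card S = CARD('n)"
    "\<And>x y. x \<in> S \<Longrightarrow> y \<in> S \<Longrightarrow> x \<bullet> (Q *v y) = (if x = y then 1 else 0)"
    using pos_def_orthonormal_set[OF assms order_refl] by metis
  then obtain e :: "'n \<Rightarrow> real^'n" where e: "bij_betw e UNIV S"
    using finite_same_card_bij[of "UNIV :: 'n set" S] by auto
  define P where "P = (\<chi> i j. e j $ i)"
  have P: "P *v axis j 1 = e j" for j
    by (simp add: P_def matrix_vector_mult_basis column_def Finite_Cartesian_Product.vec_eq_iff)
  have "(Finite_Cartesian_Product.transpose P ** Q ** P) $ i $ j = Finite_Cartesian_Product.mat 1 $ i $ j" for i j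
  proof -
    have "(Finite_Cartesian_Product.transpose P ** Q ** P) $ i $ j = e i \<bullet> (Q *v e j)"
      unfolding matrix_entry_inner[of "_ ** P"]
      by (simp only: matrix_vector_mul_assoc[symmetric] inner_matrix_vector_mult[symmetric] P)
    also have "\<dots> = (if i = j then 1 else 0)"
      using e S(3)[of "e i" "e j"] by (auto simp: bij_betw_def inj_on_def)
    finally show ?thesis by (simp add: Finite_Cartesian_Product.mat_def)
  qed
  then have "Finite_Cartesian_Product.transpose P ** Q ** P = Finite_Cartesian_Product.mat 1"
    by (simp add: Finite_Cartesian_Product.vec_eq_iff)
  then show ?thesis by (rule that)
qed

section \<open>The weighted surface measure as an image of the uniform distribution\<close>

lemma nn_integral_sphere_measure:
  fixes h :: "'a::euclidean_space \<Rightarrow> ennreal"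
  assumes [measurable]: "h \<in> borel_measurable borel"
  shows "(\<integral>\<^sup>+z. h z \<partial>sphere_measure) =
    of_nat DIM('a) * (\<integral>\<^sup>+x. h (sgn x) * indicator (cball 0 1 - {0}) x \<partial>lborel)"
proof -
  let ?B = "cball 0 1 - {0 :: 'a}" and ?S = "sphere (0 :: 'a) 1"
  have "continuous_on ?B (sgn :: 'a \<Rightarrow> 'a)"
    unfolding sgn_div_norm by (intro continuous_intros) auto
  then have "sgn \<in> measurable (restrict_space lborel ?B) (borel :: 'a measure)"
    by (subst measurable_cong_sets[OF sets_restrict_space_cong[OF sets_lborel] refl])
      (rule borel_measurable_continuous_on_restrict)
  then have [measurable]: "sgn \<in> measurable (restrict_space lborel ?B) (restrict_space borel ?S)"
    by (intro measurable_restrict_space2) (auto simp: space_restrict_space norm_sgn)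
  have [measurable]: "h \<in> borel_measurable (restrict_space borel ?S)"
    by (intro measurable_restrict_space1) simp
  show ?thesis
    unfolding sphere_measure_def
    by (simp add: nn_integral_scale_measure nn_integral_distr nn_integral_restrict_space)
qed

lemma emeasure_cball_Diff_0:
  "emeasure lborel (A \<inter> (cball 0 1 - {0 :: 'a::euclidean_space})) = emeasure lborel (A \<inter> cball 0 1)"
  if "A \<in> sets borel"
proof -
  have "A \<inter> (cball 0 1 - {0}) = A \<inter> cball 0 1 - {0 :: 'a}" by auto
  moreover have "emeasure lborel (A \<inter> cball 0 1 - {0}) = emeasure lborel (A \<inter> cball 0 1)"
    using that by (intro emeasure_Diff_null_set) auto
  ultimately show ?thesis by (simp only:)
qed

lemma measure_sphere_measure_sphere:
  "measure sphere_measure (sphere (0 :: 'a::euclidean_space) 1) =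
    real DIM('a) * measure lborel (cball (0 :: 'a) 1)"
proof -
  have "{x \<in> cball 0 1 - {0}. sgn x \<in> sphere (0 :: 'a) 1} = UNIV \<inter> (cball 0 1 - {0})"
    by (auto simp: norm_sgn)
  then have "emeasure sphere_measure (sphere (0 :: 'a) 1) =
      of_nat DIM('a) * emeasure lborel (cball (0 :: 'a) 1)"
    using emeasure_sphere_measure_vimage[of "sphere (0 :: 'a) 1"]
      emeasure_cball_Diff_0[of "UNIV :: 'a set"] by simp
  then show ?thesis
    by (simp add: measure_def enn2real_mult)
qed

lemma measure_cball_pos: "0 < measure lborel (cball (0 :: 'a::euclidean_space) 1)"
  using content_ball_pos[of 1 "0 :: 'a"] content_cball_conv_ball[of "0 :: 'a" 1] by simp

lemma quadratic_form_congruent_one: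
  fixes P Q :: "real^'n^'n"
  assumes "Finite_Cartesian_Product.transpose P ** Q ** P = Finite_Cartesian_Product.mat 1"
  shows "(P *v x) \<bullet> (Q *v (P *v y)) = x \<bullet> y"
  by (simp only: inner_matrix_vector_mult matrix_vector_mul_assoc matrix_mul_assoc assms matrix_vector_mul_lid)

lemma det_congruent_one:
  fixes P Q :: "real^'n^'n"
  assumes "Finite_Cartesian_Product.transpose P ** Q ** P = Finite_Cartesian_Product.mat 1"
  shows "0 < Determinants.det Q" and "\<bar>Determinants.det P\<bar> * sqrt (Determinants.det Q) = 1"
proof -
  have *: "(Determinants.det P)\<^sup>2 * Determinants.det Q = 1"
    using arg_cong[OF assms, of Determinants.det]
    by (simp add: det_mul Determinants.det_transpose power2_eq_square mult_ac)
  then have "0 < (Determinants.det P)\<^sup>2 * Determinants.det Q" by simp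
  then show "0 < Determinants.det Q" by (simp add: zero_less_mult_iff)
  have "sqrt ((Determinants.det P)\<^sup>2 * Determinants.det Q) = 1" by (simp add: *)
  then show "\<bar>Determinants.det P\<bar> * sqrt (Determinants.det Q) = 1" by (simp add: real_sqrt_mult)
qed

lemma congruent_one_surj:
  fixes P Q :: "real^'n^'n"
  assumes "Finite_Cartesian_Product.transpose P ** Q ** P = Finite_Cartesian_Product.mat 1"
  shows "surj ((*v) P)"
proof -
  have "x = 0" if "P *v x = 0" for x
    using quadratic_form_congruent_one[OF assms, of x x] that by simp
  then have "inj ((*v) P)" by (simp add: linear_injective_0)
  then show ?thesis by (simp add: linear_injective_imp_surjective)
qed

text \<open>
  The uniform distribution of the ball stands for that of the sphere: only \<open>sgn (P *v y)\<close> is ever used.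
  The map \<open>id\<close> changes the underlying \<open>\<sigma>\<close>-algebra from that of the sphere to that of the whole space.
\<close>

lemma distr_density_sphere_measure:
  fixes P Q :: "real^'n^'n"
  assumes Q: "pos_def Q" and P: "Finite_Cartesian_Product.transpose P ** Q ** P = Finite_Cartesian_Product.mat 1"
  shows
  "distr (density sphere_measure (\<lambda>z. ennreal (sqrt (Determinants.det Q) / sqrt (z \<bullet> (Q *v z)) ^ CARD('n) /
      measure sphere_measure (sphere (0 :: real^'n) 1)))) borel id =
   distr (uniform_measure lborel (cball 0 1)) borel (\<lambda>y. sgn (P *v y))"
    (is "distr (density _ ?w) _ _ = ?D")
proof (rule measure_eqI)
  let ?n = "CARD('n)" and ?V = "measure lborel (cball (0 :: real^'n) 1)"
  fix A assume "A \<in> sets (distr (density (sphere_measure :: (real^'n) measure) ?w) borel id)"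
  then have A[measurable]: "A \<in> sets borel" by simp
  define \<rho> where "\<rho> x = sqrt (x \<bullet> (Q *v x))" for x :: "real^'n"
  define C where "C = sqrt (Determinants.det Q) / measure sphere_measure (sphere (0 :: real^'n) 1)"
  have C: "C \<ge> 0" using det_congruent_one(1)[OF P] by (simp add: C_def)
  have [measurable]: "(\<lambda>x. M *v x) \<in> borel_measurable borel" for M :: "real^'n^'n"
    by (intro borel_measurable_continuous_onI linear_continuous_on)
      (simp add: linear_linear)
  have \<rho>_meas[measurable]: "\<rho> \<in> borel_measurable borel" unfolding \<rho>_def by measurable
  have sgn_meas[measurable]: "sgn \<in> borel_measurable (borel :: (real^'n) measure)"
    unfolding sgn_div_norm by measurable
  have \<rho>_pos: "0 < \<rho> x" if "x \<noteq> 0" for x using Q that by (simp add: \<rho>_def pos_def_def)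
  have \<rho>_hom: "\<rho> (t *\<^sub>R x) = t * \<rho> x" if "0 < t" for t x
    using that by (simp add: \<rho>_def matrix_vector_mult_scaleR real_sqrt_mult flip: mult.assoc)
  have \<rho>_P: "\<rho> (P *v y) = norm y" for y by (simp add: \<rho>_def quadratic_form_congruent_one[OF P] norm_eq_sqrt_inner)
  have [measurable]: "cball (0 :: real^'n) 1 \<in> sets borel" by simp
  have P_0: "P *v y = 0 \<longleftrightarrow> y = 0" for y using \<rho>_P[of y] by (auto simp: \<rho>_def)
  \<comment> \<open>The indicator of the cone over \<open>A\<close> without its apex, so that
    \<open>u\<close> is constant along rays and \<open>u 0 = 0\<close> even if \<open>A\<close>
    contains 0.\<close>
  define u where "u x = (indicator {x. x \<noteq> 0 \<and> sgn x \<in> A} x :: ennreal)" for x :: "real^'n"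
  have u_meas[measurable]: "u \<in> borel_measurable borel" unfolding u_def by measurable
  have w_meas[measurable]: "?w \<in> borel_measurable borel"
    unfolding \<rho>_def[symmetric] by measurable
  have [measurable]: "id \<in> measurable (sphere_measure :: (real^'n) measure) borel"
    by (subst measurable_cong_sets[OF sets_sphere_measure refl]) (simp add: measurable_restrict_space1)
  have [measurable]: "f \<in> borel_measurable sphere_measure" if "f \<in> borel_measurable borel" for f :: "real^'n \<Rightarrow> ennreal"
    using that by (subst measurable_cong_sets[OF sets_sphere_measure refl]) (simp add: measurable_restrict_space1)
  \<comment> \<open>The preimage under \<open>P\<close> of the cone over \<open>A\<close>, cut off
    by the unit ball. As \<rho> (P y) = norm y, the map \<open>P\<close> sends it onto the part of
    the cone where \<rho> <= 1.\<close>
  define T where "T = {y \<in> cball 0 1. y \<noteq> 0 \<and> sgn (P *v y) \<in> A}"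
  have T_meas[measurable]: "T \<in> sets borel" unfolding T_def by measurable
  have "bounded T" by (rule bounded_subset[OF bounded_cball[of 0 1]]) (auto simp: T_def)
  then have T: "T \<in> lmeasurable" using T_meas by (intro bounded_set_imp_lmeasurable) auto
  have P_image: "{x. x \<noteq> 0 \<and> sgn x \<in> A \<and> \<rho> x \<le> 1} = (*v) P ` T"
  proof (intro equalityI subsetI)
    fix x assume "x \<in> {x. x \<noteq> 0 \<and> sgn x \<in> A \<and> \<rho> x \<le> 1}"
    moreover obtain y where "x = P *v y" using congruent_one_surj[OF P] by (metis surjD)
    ultimately show "x \<in> (*v) P ` T" by (auto simp: \<rho>_P T_def)
  qed (auto simp: T_def \<rho>_P P_0)
  have "emeasure (distr (density sphere_measure ?w) borel id) A =
      (\<integral>\<^sup>+z. ?w z * indicator A z \<partial>sphere_measure)"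
  proof -
    have m: "id \<in> measurable (density (sphere_measure :: (real^'n) measure) ?w) borel" by measurable
    have "id -` A \<inter> space (density (sphere_measure :: (real^'n) measure) ?w) \<in> sets (sphere_measure :: (real^'n) measure)"
      using measurable_sets[OF m A] by simp
    then show ?thesis
      by (subst emeasure_distr[OF m A]) (auto simp: emeasure_density intro!: nn_integral_cong split: split_indicator)
  qed
  also have "\<dots> = of_nat ?n * (\<integral>\<^sup>+x. ?w (sgn x) * indicator A (sgn x) * indicator (cball 0 1 - {0}) x \<partial>lborel)"
    by (subst nn_integral_sphere_measure) auto
  also have "(\<integral>\<^sup>+x. ?w (sgn x) * indicator A (sgn x) * indicator (cball 0 1 - {0}) x \<partial>lborel) =
      (\<integral>\<^sup>+x. ennreal C * (u x * ennreal ((norm x / \<rho> x) ^ ?n) * indicator (cball 0 1) x) \<partial>lborel)"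
  proof (rule nn_integral_cong)
    fix x :: "real^'n"
    show "?w (sgn x) * indicator A (sgn x) * indicator (cball 0 1 - {0}) x =
      ennreal C * (u x * ennreal ((norm x / \<rho> x) ^ ?n) * indicator (cball 0 1) x)"
    proof (cases "x = 0")
      case False
      then have "\<rho> (sgn x) = \<rho> x / norm x" by (simp add: sgn_div_norm \<rho>_hom field_simps)
      then have "?w (sgn x) = ennreal (C * (norm x / \<rho> x) ^ ?n)"
        unfolding \<rho>_def[symmetric] C_def by (simp add: power_divide mult.commute)
      also have "\<dots> = ennreal C * ennreal ((norm x / \<rho> x) ^ ?n)"
        using C \<rho>_pos[OF False] by (simp add: ennreal_mult')
      finally show ?thesis using False by (simp add: u_def indicator_def)
    qed (simp add: u_def)
  qed
  also have "\<dots> = ennreal C * (\<integral>\<^sup>+x. u x * ennreal ((norm x / \<rho> x) ^ ?n) * indicator (cball 0 1) x \<partial>lborel)"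
    by (rule nn_integral_cmult) measurable
  also have "(\<integral>\<^sup>+x. u x * ennreal ((norm x / \<rho> x) ^ ?n) * indicator (cball 0 1) x \<partial>lborel) =
      (\<integral>\<^sup>+x. u x * indicator {x. \<rho> x \<le> 1} x \<partial>lborel)"
    using sector_nn_integral_cball[OF \<rho>_meas u_meas \<rho>_pos \<rho>_hom]
    by (simp add: u_def indicator_def sgn_scaleR)
  also have "\<dots> = (\<integral>\<^sup>+x. indicator ((*v) P ` T) x \<partial>lborel)"
    by (intro nn_integral_cong) (auto simp: u_def indicator_def simp flip: P_image)
  also have "\<dots> = emeasure lborel ((*v) P ` T)"
    by (rule nn_integral_indicator) (simp flip: P_image)
  also have "\<dots> = ennreal (\<bar>Determinants.det P\<bar> * measure lebesgue T)"
  proof -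
    have "(*v) P ` T \<in> sets borel" by (simp flip: P_image)
    then have "emeasure lborel ((*v) P ` T) = emeasure lebesgue ((*v) P ` T)" by simp
    also have "\<dots> = ennreal (measure lebesgue ((*v) P ` T))"
      using measure_linear_image_cart[OF matrix_vector_mul_linear T] by (intro emeasure_eq_measure2) auto
    finally show ?thesis
      using measure_linear_image_cart[OF matrix_vector_mul_linear T, of P] by simp
  qed
  also have "of_nat ?n * (ennreal C * ennreal (\<bar>Determinants.det P\<bar> * measure lebesgue T)) =
      ennreal (real ?n * (C * (\<bar>Determinants.det P\<bar> * measure lebesgue T)))"
    using C by (simp add: ennreal_of_nat_eq_real_of_nat flip: ennreal_mult')
  \<comment> \<open>The dimension cancels against the area \<open>real ?n * ?V\<close> of the sphere
    and |det P| sqrt(det Q) = 1, so only the fraction of the ball filled by \<open>T\<close> is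
    left.\<close>
  also have "real ?n * (C * (\<bar>Determinants.det P\<bar> * measure lebesgue T)) = measure lebesgue T / ?V"
  proof -
    have "C = sqrt (Determinants.det Q) / (real ?n * ?V)"
      by (simp add: C_def measure_sphere_measure_sphere)
    then have "real ?n * (C * (\<bar>Determinants.det P\<bar> * measure lebesgue T)) =
        (\<bar>Determinants.det P\<bar> * sqrt (Determinants.det Q)) * (measure lebesgue T / ?V)"
      using measure_cball_pos[where 'a = "real^'n"] by (simp add: field_simps)
    then show ?thesis by (simp only: det_congruent_one(2)[OF P] mult_1)
  qed
  also have "ennreal (measure lebesgue T / ?V) = emeasure lborel T / emeasure lborel (cball (0 :: real^'n) 1)"
  proof -
    have "emeasure lborel T = ennreal (measure lebesgue T)"
      using T T_meas emeasure_eq_measure2[OF T] by simp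
    moreover have "emeasure lborel (cball (0 :: real^'n) 1) = ennreal ?V"
      using emeasure_lborel_cball_finite[of "0 :: real^'n" 1]
      by (intro emeasure_eq_ennreal_measure) auto
    ultimately show ?thesis using measure_cball_pos[where 'a = "real^'n"] by (simp add: divide_ennreal)
  qed
  also have "emeasure lborel T = emeasure lborel ((\<lambda>y. sgn (P *v y)) -` A \<inter> (cball 0 1 - {0}))"
    by (intro arg_cong[where f = "emeasure lborel"]) (auto simp: T_def)
  also have "\<dots> = emeasure lborel ((\<lambda>y. sgn (P *v y)) -` A \<inter> cball 0 1)"
    by (rule emeasure_cball_Diff_0) (rule measurable_sets_borel[OF _ A], measurable)
  also have "\<dots> / emeasure lborel (cball (0 :: real^'n) 1) = emeasure ?D A"
  proof -
    have "(\<lambda>y. sgn (P *v y)) -` A \<in> sets borel" by (rule measurable_sets_borel[OF _ A]) measurable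
    then show ?thesis by (simp add: emeasure_distr emeasure_uniform_measure Int_commute)
  qed
  finally show "emeasure (distr (density sphere_measure ?w) borel id) A = emeasure ?D A" .
qed simp

section \<open>Forms\<close>

lemma monomial_add: "monomial (\<lambda>k. \<alpha> k + \<beta> k) x = monomial \<alpha> x * monomial \<beta> x"
  by (simp add: monomial_def power_add prod.distrib)

lemma exponents_add: "\<alpha> \<in> exponents j \<Longrightarrow> \<beta> \<in> exponents k \<Longrightarrow> (\<lambda>i. \<alpha> i + \<beta> i) \<in> exponents (j + k)"
  by (simp add: exponents_def sum.distrib)

lemma form_monomial: "\<alpha> \<in> exponents k \<Longrightarrow> form k (monomial \<alpha>)"
  unfolding form_def
  by (rule exI[of _ "\<lambda>\<beta>. if \<beta> = \<alpha> then 1 else 0"])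
    (simp add: finite_exponents if_distrib[of "\<lambda>c. c * _"] sum.delta cong: if_cong)

lemma form_sum:
  assumes "\<And>i. i \<in> I \<Longrightarrow> form k (f i)"
  shows "form k (\<lambda>x. \<Sum>i\<in>I. c i * f i x)"
proof -
  obtain d where d: "\<And>i x. i \<in> I \<Longrightarrow> f i x = (\<Sum>\<alpha>\<in>exponents k. d i \<alpha> * monomial \<alpha> x)"
    using assms unfolding form_def by metis
  have "(\<Sum>i\<in>I. c i * f i x) = (\<Sum>\<alpha>\<in>exponents k. (\<Sum>i\<in>I. c i * d i \<alpha>) * monomial \<alpha> x)" for x
  proof -
    have "(\<Sum>i\<in>I. c i * f i x) = (\<Sum>i\<in>I. \<Sum>\<alpha>\<in>exponents k. c i * d i \<alpha> * monomial \<alpha> x)"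
      by (simp add: d sum_distrib_left mult.assoc)
    also have "\<dots> = (\<Sum>\<alpha>\<in>exponents k. \<Sum>i\<in>I. c i * d i \<alpha> * monomial \<alpha> x)" by (rule sum.swap)
    finally show ?thesis by (simp add: sum_distrib_right)
  qed
  then show ?thesis
    unfolding form_def by (intro exI[of _ "\<lambda>\<alpha>. \<Sum>i\<in>I. c i * d i \<alpha>"] allI)
qed

lemma form_cmult: "form k f \<Longrightarrow> form k (\<lambda>x. c * f x)"
  using form_sum[of "{()}" k "\<lambda>_. f" "\<lambda>_. c"] by simp

lemma form_expand:
  assumes "form k f"
  obtains c where "f = (\<lambda>x. \<Sum>\<alpha>\<in>exponents k. c \<alpha> * monomial \<alpha> x)"
  using assms unfolding form_def by blast

lemma form_mult:
  assumes "form j f" "form k g"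
  shows "form (j + k) (\<lambda>x. f x * g x)"
proof -
  obtain c where c: "f = (\<lambda>x. \<Sum>\<alpha>\<in>exponents j. c \<alpha> * monomial \<alpha> x)" using form_expand[OF assms(1)] .
  obtain d where d: "g = (\<lambda>x. \<Sum>\<alpha>\<in>exponents k. d \<alpha> * monomial \<alpha> x)" using form_expand[OF assms(2)] .
  have "(\<lambda>x. f x * g x) = (\<lambda>x. \<Sum>(\<alpha>, \<beta>)\<in>exponents j \<times> exponents k.
      (c \<alpha> * d \<beta>) * monomial (\<lambda>i. \<alpha> i + \<beta> i) x)"
    unfolding c d
    by (rule ext) (simp add: sum_product sum.cartesian_product monomial_add mult_ac)
  also have "\<dots> = (\<lambda>x. \<Sum>p\<in>exponents j \<times> exponents k.
      (c (fst p) * d (snd p)) * monomial (\<lambda>i. fst p i + snd p i) x)"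
    by (simp add: case_prod_beta)
  finally have eq: "(\<lambda>x. f x * g x) = (\<lambda>x. \<Sum>p\<in>exponents j \<times> exponents k.
      (c (fst p) * d (snd p)) * monomial (\<lambda>i. fst p i + snd p i) x)" .
  show ?thesis unfolding eq
    by (rule form_sum, rule form_monomial, rule exponents_add) auto
qed

lemma form_const: "form 0 (\<lambda>_. c)"
proof -
  have "form 0 (monomial (\<lambda>_. 0))" by (rule form_monomial) (simp add: exponents_def)
  from form_cmult[OF this, of c] show ?thesis by (simp add: monomial_def)
qed

lemma form_power: "form k f \<Longrightarrow> form (m * k) (\<lambda>x. f x ^ m)"
  by (induction m) (auto intro: form_const form_mult)

lemma form_prod:
  assumes "finite I" "\<And>i. i \<in> I \<Longrightarrow> form (k i) (f i)"
  shows "form (\<Sum>i\<in>I. k i) (\<lambda>x. \<Prod>i\<in>I. f i x)"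
  using assms by (induction I rule: finite_induct) (auto intro: form_const form_mult)

lemma form_component: "form 1 (\<lambda>x. x $ i)"
proof -
  have "form 1 (monomial (\<lambda>j. if j = i then 1 else 0))"
    by (rule form_monomial) (simp add: exponents_def)
  moreover have "monomial (\<lambda>j. if j = i then 1 else 0) = (\<lambda>x. x $ i)"
    by (rule ext) (simp add: monomial_def if_distrib[of "\<lambda>k. _ ^ k"] prod.delta cong: if_cong)
  ultimately show ?thesis by simp
qed

lemma form_matrix_component: "form 1 (\<lambda>x. (A *v x) $ i)"
  unfolding matrix_vector_mult_def vec_lambda_beta by (rule form_sum) (rule form_component)

text \<open>The substitution replaces every variable by a linear form, so a monomial of degree
  \<open>k\<close> becomes a product of \<open>k\<close> linear forms.\<close>

lemma form_compose_matrix: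
  assumes "form k f"
  shows "form k (\<lambda>x. f (A *v x))"
proof -
  obtain c where c: "f = (\<lambda>x. \<Sum>\<alpha>\<in>exponents k. c \<alpha> * monomial \<alpha> x)" using form_expand[OF assms] .
  have "form k (\<lambda>x. monomial \<alpha> (A *v x))" if "\<alpha> \<in> exponents k" for \<alpha>
  proof -
    have "form (\<Sum>i\<in>UNIV. \<alpha> i * 1) (\<lambda>x. \<Prod>i\<in>UNIV. ((A *v x) $ i) ^ \<alpha> i)"
      by (intro form_prod form_power form_matrix_component finite)
    with that show ?thesis by (simp add: monomial_def exponents_def)
  qed
  then show ?thesis unfolding c by (rule form_sum)
qed

lemma form_scaleR:
  assumes "form k f"
  shows "f (t *\<^sub>R x) = t ^ k * f x"
proof -
  obtain c where c: "f = (\<lambda>x. \<Sum>\<alpha>\<in>exponents k. c \<alpha> * monomial \<alpha> x)" using form_expand[OF assms] .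
  have "monomial \<alpha> (t *\<^sub>R x) = t ^ k * monomial \<alpha> x" if "\<alpha> \<in> exponents k" for \<alpha>
    using that by (simp add: monomial_def exponents_def power_mult_distrib prod.distrib flip: power_sum)
  then show ?thesis by (simp add: c sum_distrib_left mult.left_commute)
qed

lemma form_zero:
  assumes "form k f" "0 < k"
  shows "f 0 = 0"
  using form_scaleR[OF assms(1), of 0 0] assms(2) by (simp add: zero_power)

lemma form_continuous: "form k f \<Longrightarrow> continuous_on UNIV f"
  by (erule form_expand) (auto simp: monomial_def intro!: continuous_intros)

section \<open>Powers of sums of squares\<close>

text \<open>The squares on the right are those of all products \<open>p i x * s j x\<close>. The
  bijection \<open>e\<close> numbers the pairs, since \<open>sos_form\<close> indexes its squares by
  natural numbers.\<close>

lemma sos_mult: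
  fixes p :: "nat \<Rightarrow> real^'n \<Rightarrow> real"
  assumes "finite J" "\<forall>i<r. form k (p i)" "\<And>j. j \<in> J \<Longrightarrow> form l (s j)"
  obtains p' r' where "\<forall>i<r'. form (k + l) (p' i :: real^'n \<Rightarrow> real)"
    "\<And>x. (\<Sum>i<r. (p i x)\<^sup>2) * (\<Sum>j\<in>J. (s j x)\<^sup>2) = (\<Sum>i<(r' :: nat). (p' i x)\<^sup>2)"
proof -
  let ?I = "{..<r} \<times> J"
  obtain e where e: "bij_betw e {..<card ?I} ?I"
    using ex_bij_betw_nat_finite[of ?I] assms(1) by (auto simp: lessThan_atLeast0)
  let ?p = "\<lambda>(i, j) x. p i x * s j x"
  have "form (k + l) (?p (e m))" if "m < card ?I" for m
  proof -
    have "e m \<in> ?I" using e that by (auto simp: bij_betw_def)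
    then show ?thesis using assms by (cases "e m") (auto intro: form_mult)
  qed
  moreover have "(\<Sum>i<r. (p i x)\<^sup>2) * (\<Sum>j\<in>J. (s j x)\<^sup>2) = (\<Sum>m<card ?I. (?p (e m) x)\<^sup>2)" for x
  proof -
    have "(\<Sum>m<card ?I. (?p (e m) x)\<^sup>2) = (\<Sum>z\<in>?I. (?p z x)\<^sup>2)"
      by (rule sum.reindex_bij_betw[OF e])
    also have "\<dots> = (\<Sum>(i, j)\<in>?I. (p i x)\<^sup>2 * (s j x)\<^sup>2)"
      by (rule sum.cong) (auto simp: power_mult_distrib)
    finally show ?thesis by (simp add: sum_product sum.cartesian_product)
  qed
  ultimately show ?thesis using that[of "card ?I" "\<lambda>m. ?p (e m)"] by blast
qed

lemma sos_form_power_sum_squares: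
  fixes s :: "'j \<Rightarrow> real^'n \<Rightarrow> real"
  assumes "finite J" "\<And>j. j \<in> J \<Longrightarrow> form 1 (s j)"
  shows "sos_form (2 * k) (\<lambda>x. (\<Sum>j\<in>J. (s j x)\<^sup>2) ^ k)"
proof -
  have "\<exists>(p :: nat \<Rightarrow> real^'n \<Rightarrow> real) r. (\<forall>i<r. form k (p i)) \<and>
    (\<forall>x. (\<Sum>j\<in>J. (s j x)\<^sup>2) ^ k = (\<Sum>i<r. (p i x)\<^sup>2))"
  proof (induction k)
    case 0
    show ?case by (intro exI[of _ "\<lambda>_ _. 1"] exI[of _ 1]) (simp add: form_const)
  next
    case (Suc k)
    then obtain p :: "nat \<Rightarrow> real^'n \<Rightarrow> real" and r where
      p: "\<forall>i<r. form k (p i)" "\<And>x. (\<Sum>j\<in>J. (s j x)\<^sup>2) ^ k = (\<Sum>i<r. (p i x)\<^sup>2)" by metis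
    obtain p' :: "nat \<Rightarrow> real^'n \<Rightarrow> real" and r' where "\<forall>i<r'. form (k + 1) (p' i)"
      "\<And>x. (\<Sum>i<r. (p i x)\<^sup>2) * (\<Sum>j\<in>J. (s j x)\<^sup>2) = (\<Sum>i<r'. (p' i x)\<^sup>2)"
      using sos_mult[OF assms(1) p(1), of 1 s] assms(2) by metis
    then show ?case
      by (intro exI[of _ p'] exI[of _ r']) (simp add: p(2) mult.commute)
  qed
  moreover have "form (k * 2) (\<lambda>x. (\<Sum>j\<in>J. (s j x)\<^sup>2) ^ k)"
  proof (rule form_power)
    have "form 2 (\<lambda>x. \<Sum>j\<in>J. 1 * (s j x)\<^sup>2)"
    proof (rule form_sum)
      show "form 2 (\<lambda>x. (s j x)\<^sup>2)" if "j \<in> J" for j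
        using form_power[OF assms(2)[OF that], of 2] by simp
    qed
    then show "form 2 (\<lambda>x. \<Sum>j\<in>J. (s j x)\<^sup>2)" by simp
  qed
  ultimately show ?thesis by (simp add: sos_form_def mult.commute)
qed

section \<open>Linear independence and number of the monomials\<close>

text \<open>With all other variables fixed, the sum is a polynomial in the variable
  \<open>i\<close>. Its coefficients vanish, and each is a sum of the same kind over the remaining
  variables. Injectivity is required on \<open>I\<close> only, because exponents with the same value
  at \<open>i\<close> that differ on \<open>insert i I\<close> must differ on \<open>I\<close>; this
  lets the induction pass to subsets of \<open>A\<close>.\<close>

lemma sum_monomial_eq_0_imp:
  fixes A :: "('n::finite \<Rightarrow> nat) set"
  assumes "finite I" "finite A" "inj_on (\<lambda>\<alpha>. restrict \<alpha> I) A"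
    and "\<And>x :: 'n \<Rightarrow> real. (\<Sum>\<alpha>\<in>A. c \<alpha> * (\<Prod>i\<in>I. x i ^ \<alpha> i)) = 0" and "\<alpha> \<in> A"
  shows "c \<alpha> = 0"
  using assms
proof (induction I arbitrary: A \<alpha> rule: finite_induct)
  case empty
  then have "A = {\<alpha>}" by (auto simp: inj_on_def)
  with empty.prems(3) show ?case by simp
next
  case (insert i I)
  let ?A = "{\<beta> \<in> A. \<beta> i = \<alpha> i}"
  show ?case
  proof (rule insert.IH)
    show "finite ?A" "\<alpha> \<in> ?A" using insert.prems by auto
    show "inj_on (\<lambda>\<alpha>. restrict \<alpha> I) ?A"
    proof (rule inj_onI)
      fix \<beta> \<gamma> assume \<beta>: "\<beta> \<in> ?A" and \<gamma>: "\<gamma> \<in> ?A" and eq: "restrict \<beta> I = restrict \<gamma> I"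
      have "\<beta> j = \<gamma> j" if "j \<in> I" for j using fun_cong[OF eq, of j] that by simp
      then have eq': "restrict \<beta> (insert i I) = restrict \<gamma> (insert i I)"
        using \<beta> \<gamma> by (auto simp: restrict_def fun_eq_iff)
      show "\<beta> = \<gamma>" by (rule inj_onD[OF insert.prems(2)]) (use eq' \<beta> \<gamma> in simp_all)
    qed
    fix x :: "'n \<Rightarrow> real"
    \<comment> \<open>The coefficient of \<open>t ^ m\<close> after the variable \<open>i\<close> is
      set to \<open>t\<close>.\<close>
    define b where "b m = (\<Sum>\<beta> | \<beta> \<in> A \<and> \<beta> i = m. c \<beta> * (\<Prod>j\<in>I. x j ^ \<beta> j))" for m
    define d where "d = Max ((\<lambda>\<beta>. \<beta> i) ` A)"
    have d: "\<beta> i \<le> d" if "\<beta> \<in> A" for \<beta> using that insert.prems(1) by (simp add: d_def)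
    have "(\<Sum>m\<le>d. b m * t ^ m) = 0" for t
    proof -
      have "(\<Sum>m\<le>d. b m * t ^ m) =
        (\<Sum>m\<le>d. \<Sum>\<beta> | \<beta> \<in> A \<and> \<beta> i = m. c \<beta> * (t ^ \<beta> i * (\<Prod>j\<in>I. x j ^ \<beta> j)))"
        unfolding b_def sum_distrib_right by (intro sum.cong refl) (auto simp: mult_ac)
      also have "\<dots> = (\<Sum>\<beta>\<in>A. c \<beta> * (t ^ \<beta> i * (\<Prod>j\<in>I. x j ^ \<beta> j)))"
        by (rule sum.group) (use insert.prems(1) d in auto)
      also have "\<dots> = (\<Sum>\<beta>\<in>A. c \<beta> * (\<Prod>j\<in>insert i I. (x(i := t)) j ^ \<beta> j))"
      proof -
        have "(\<Prod>j\<in>I. (x(i := t)) j ^ \<beta> j) = (\<Prod>j\<in>I. x j ^ \<beta> j)" for \<beta>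
          using insert.hyps(2) by (intro prod.cong refl) (metis fun_upd_other)
        then show ?thesis using insert.hyps by simp
      qed
      also have "\<dots> = 0" by (rule insert.prems(3))
      finally show ?thesis .
    qed
    then have "b (\<alpha> i) = 0" using polyfun_eq_0[of b d] d[OF insert.prems(4)] by blast
    then show "(\<Sum>\<beta>\<in>?A. c \<beta> * (\<Prod>j\<in>I. x j ^ \<beta> j)) = 0" by (simp add: b_def)
  qed
qed

lemma monomials_independent:
  fixes c :: "('n::finite \<Rightarrow> nat) \<Rightarrow> real"
  assumes "\<And>x. (\<Sum>\<alpha>\<in>exponents k. c \<alpha> * monomial \<alpha> x) = 0" and "\<alpha> \<in> exponents k"
  shows "c \<alpha> = 0"
proof (rule sum_monomial_eq_0_imp[OF _ finite_exponents _ _ assms(2)])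
  show "inj_on (\<lambda>\<alpha>. restrict \<alpha> UNIV) (exponents k :: ('n \<Rightarrow> nat) set)"
    by (simp add: inj_on_def restrict_def)
  show "(\<Sum>\<alpha>\<in>exponents k. c \<alpha> * (\<Prod>i\<in>UNIV. x i ^ \<alpha> i)) = 0" for x :: "'n \<Rightarrow> real"
    using assms(1)[of "\<chi> i. x i"] by (simp add: monomial_def)
qed simp

text \<open>Stars and bars: listing the values of an exponent vector along an enumeration of the
  variables gives the lists of length n with sum \<open>k\<close>.\<close>

lemma card_exponents:
  "card (exponents k :: ('n::finite \<Rightarrow> nat) set) = (k + CARD('n) - 1) choose (CARD('n) - 1)"
proof -
  let ?n = "CARD('n)"
  obtain e :: "nat \<Rightarrow> 'n" where e: "bij_betw e {..<?n} UNIV"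
    using ex_bij_betw_nat_finite[of "UNIV :: 'n set"] by (auto simp: lessThan_atLeast0)
  have e_surj: "\<exists>i<?n. e i = j" for j using e by (metis UNIV_I bij_betw_iff_bijections lessThan_iff)
  let ?f = "\<lambda>\<alpha> :: 'n \<Rightarrow> nat. map (\<lambda>i. \<alpha> (e i)) [0..<?n]"
  have sum_f: "sum_list (?f \<alpha>) = (\<Sum>i\<in>UNIV. \<alpha> i)" for \<alpha>
    using sum.reindex_bij_betw[OF e, of \<alpha>] by (simp add: sum_list_sum_nth lessThan_atLeast0)
  have "bij_betw ?f (exponents k) {l. length l = ?n \<and> sum_list l = k}"
  proof (rule bij_betwI')
    fix \<alpha> \<beta> :: "'n \<Rightarrow> nat"
    show "?f \<alpha> = ?f \<beta> \<longleftrightarrow> \<alpha> = \<beta>"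
    proof
      assume "?f \<alpha> = ?f \<beta>"
      then have "\<alpha> (e i) = \<beta> (e i)" if "i < ?n" for i using that by (auto simp: list_eq_iff_nth_eq)
      then show "\<alpha> = \<beta>" using e_surj by (metis ext)
    qed simp
    show "?f \<alpha> \<in> {l. length l = ?n \<and> sum_list l = k}" if "\<alpha> \<in> exponents k"
      using that sum_f by (simp add: exponents_def)
  next
    fix l :: "nat list" assume l: "l \<in> {l. length l = ?n \<and> sum_list l = k}"
    let ?\<alpha> = "\<lambda>j. l ! the_inv_into {..<?n} e j"
    have "the_inv_into {..<?n} e (e i) = i" if "i < ?n" for i
      using e that by (simp add: bij_betw_def the_inv_into_f_f)
    then have eq: "?f ?\<alpha> = l" using l by (intro nth_equalityI) auto
    have "?\<alpha> \<in> exponents k" using sum_f[of ?\<alpha>] l unfolding eq by (simp add: exponents_def)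
    from bexI[of "\<lambda>\<alpha>. l = ?f \<alpha>", OF eq[symmetric] this] show "\<exists>\<alpha>\<in>exponents k. l = ?f \<alpha>" .
  qed
  then have "card (exponents k :: ('n \<Rightarrow> nat) set) = (k + ?n - 1) choose k"
    by (simp add: bij_betw_same_card card_length_sum_list)
  also have "\<dots> = (k + ?n - 1) choose (?n - 1)"
    using zero_less_card_finite[where 'a = 'n] by (subst binomial_symmetric) auto
  finally show ?thesis .
qed

section \<open>The moment functional as a spherical mean\<close>

text \<open>The integrand is constant along rays, so averaging over the ball has the effect of
  averaging over the sphere. Only the null point \<open>y = 0\<close> is not sent to the sphere, as
  \<open>sgn 0 = 0\<close>.\<close>

definition sphere_mean :: "('a::euclidean_space \<Rightarrow> real) \<Rightarrow> real" where
  "sphere_mean h = (LINT y|uniform_measure lborel (cball 0 1). h (sgn y))"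

lemma emeasure_uniform_cball:
  "emeasure (uniform_measure lborel (cball (0 :: 'a::euclidean_space) 1)) UNIV = 1"
proof -
  have "emeasure lborel (cball (0 :: 'a) 1) \<noteq> 0"
    using measure_cball_pos[where 'a = 'a] by (auto simp: measure_def)
  moreover have "emeasure lborel (cball (0 :: 'a) 1) \<noteq> \<infinity>"
    using emeasure_lborel_cball_finite[of "0 :: 'a" 1] by auto
  ultimately show ?thesis by (simp add: ennreal_divide_self less_top)
qed

lemma finite_measure_uniform_cball:
  "finite_measure (uniform_measure lborel (cball (0 :: 'a::euclidean_space) 1))"
  by (rule finite_measureI) (simp add: emeasure_uniform_cball)

lemma borel_measurable_sgn_compose:
  fixes h :: "'a::euclidean_space \<Rightarrow> real"
  assumes "continuous_on UNIV h"
  shows "(\<lambda>y. h (sgn y)) \<in> borel_measurable borel"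
proof -
  have [measurable]: "h \<in> borel_measurable borel" by (rule borel_measurable_continuous_onI[OF assms])
  show ?thesis unfolding sgn_div_norm by measurable
qed

lemma integrable_sphere_mean:
  fixes h :: "'a::euclidean_space \<Rightarrow> real"
  assumes "continuous_on UNIV h"
  shows "integrable (uniform_measure lborel (cball 0 1)) (\<lambda>y. h (sgn y))"
proof -
  interpret finite_measure "uniform_measure lborel (cball (0 :: 'a) 1)"
    by (rule finite_measure_uniform_cball)
  \<comment> \<open>The bound is taken on the closed ball instead of the sphere to cover
    \<open>sgn 0 = 0\<close>.\<close>
  have "compact (h ` cball 0 1)"
    using assms by (intro compact_continuous_image) (auto intro: continuous_on_subset)
  then obtain C where "\<And>x. x \<in> cball 0 1 \<Longrightarrow> norm (h x) \<le> C"
    unfolding bounded_iff using compact_imp_bounded by (metis bounded_iff imageI)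
  then have "norm (h (sgn y)) \<le> C" for y by (simp add: norm_sgn)
  then show ?thesis
    using borel_measurable_sgn_compose[OF assms]
    by (intro integrable_const_bound[of _ C]) (auto simp: measurable_def)
qed

lemma sphere_mean_sum:
  assumes "\<And>i. i \<in> I \<Longrightarrow> continuous_on UNIV (f i)"
  shows "sphere_mean (\<lambda>x. \<Sum>i\<in>I. c i * f i x) = (\<Sum>i\<in>I. c i * sphere_mean (f i))"
  unfolding sphere_mean_def
  by (subst Bochner_Integration.integral_sum) (auto intro: integrable_sphere_mean assms)

lemma sphere_mean_const:
  fixes h :: "'a::euclidean_space \<Rightarrow> real"
  assumes "continuous_on UNIV h" "\<And>x. norm x = 1 \<Longrightarrow> h x = c"
  shows "sphere_mean h = c"
proof -
  let ?U = "uniform_measure lborel (cball (0 :: 'a) 1)"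
  have "AE y in lborel. y \<noteq> (0 :: 'a)" by (rule AE_lborel_singleton)
  then have "AE y in ?U. h (sgn y) = c"
    by (intro AE_uniform_measureI) (auto simp: assms(2) norm_sgn)
  then have "sphere_mean h = (LINT y|?U. c)"
    unfolding sphere_mean_def
    using borel_measurable_sgn_compose[OF assms(1)] by (intro integral_cong_AE) (auto simp: measurable_def)
  then show ?thesis by (simp add: measure_def emeasure_uniform_cball)
qed

text \<open>If the mean were 0, then \<open>h (sgn y)\<close> would vanish for almost all
  \<open>y\<close> in the ball. It is nonzero on an open set around z / 2, and a nonempty open set
  is not negligible.\<close>

lemma sphere_mean_pos:
  fixes h :: "'a::euclidean_space \<Rightarrow> real"
  assumes h: "continuous_on UNIV h" "\<And>x. 0 \<le> h x" and z: "norm z = 1" "h z \<noteq> 0"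
  shows "0 < sphere_mean h"
proof -
  let ?U = "uniform_measure lborel (cball (0 :: 'a) 1)"
  have "sphere_mean h \<noteq> 0"
  proof
    assume "sphere_mean h = 0"
    then have "AE y in ?U. h (sgn y) = 0"
      unfolding sphere_mean_def
      using integral_nonneg_eq_0_iff_AE[OF integrable_sphere_mean[OF h(1)]] h(2) by simp
    then have ae: "AE y in lborel. y \<in> cball 0 1 \<longrightarrow> h (sgn y) = 0"
      using emeasure_lborel_cball_finite[of "0 :: 'a" 1]
      by (subst (asm) AE_uniform_measure) (use measure_cball_pos[where 'a = 'a] in \<open>auto simp: measure_def\<close>)
    \<comment> \<open>The origin is taken out because \<open>sgn\<close> is discontinuous
      there.\<close>
    define O' where "O' = {y \<in> ball 0 1 - {0}. h (sgn y) \<noteq> 0}"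
    have "continuous_on (ball 0 1 - {0}) (\<lambda>y. h (sgn y))"
      unfolding sgn_div_norm
      by (intro continuous_on_compose2[OF h(1)] continuous_intros) auto
    then have "open ((ball 0 1 - {0}) \<inter> (\<lambda>y. h (sgn y)) -` (- {0}))"
      by (intro continuous_open_preimage) auto
    also have "(ball 0 1 - {0}) \<inter> (\<lambda>y. h (sgn y)) -` (- {0}) = O'" by (auto simp: O'_def)
    finally have O': "open O'" .
    have "(1/2) *\<^sub>R z \<in> O'" using z by (auto simp: O'_def sgn_scaleR sgn_div_norm)
    then have "\<not> negligible O'" using open_not_negligible[OF O'] by blast
    moreover have "AE y in lborel. y \<notin> O'" using ae by eventually_elim (auto simp: O'_def)
    then have "O' \<in> null_sets lborel" using O' by (subst AE_iff_null_sets) auto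
    then have "negligible O'" by (simp add: negligible_iff_null_sets null_sets_completionI)
    ultimately show False by blast
  qed
  moreover have "0 \<le> sphere_mean h" unfolding sphere_mean_def using h(2) by simp
  ultimately show ?thesis by simp
qed

lemma moment_functional_eq_sphere_mean:
  fixes Q P :: "real^'n^'n"
  assumes Q: "pos_def Q" and P: "Finite_Cartesian_Product.transpose P ** Q ** P = Finite_Cartesian_Product.mat 1"
    and d: "d > 0" and g: "form d g"
  shows "moment_functional d Q g =
    real ((d div 2 + CARD('n) - 1) choose (CARD('n) - 1)) * sphere_mean (\<lambda>x. g (P *v x))"
proof -
  let ?n = "CARD('n)"
  let ?W = "density sphere_measure (\<lambda>z. ennreal (sqrt (Determinants.det Q) / sqrt (z \<bullet> (Q *v z)) ^ ?n /
      measure sphere_measure (sphere (0 :: real^'n) 1)))"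
  let ?U = "uniform_measure lborel (cball (0 :: real^'n) 1)"
  define N where "N = real ((d div 2 + ?n - 1) choose (?n - 1))"
  define \<rho> where "\<rho> x = sqrt (x \<bullet> (Q *v x))" for x :: "real^'n"
  define f where "f z = N / \<rho> z ^ d" for z
  have \<rho>_pos: "0 < \<rho> x" if "x \<noteq> 0" for x using Q that by (simp add: \<rho>_def pos_def_def)
  have \<rho>_nonneg: "0 \<le> \<rho> x" for x using \<rho>_pos[of x] by (cases "x = 0") (auto simp: \<rho>_def)
  have \<rho>_scale: "\<rho> (t *\<^sub>R x) = \<bar>t\<bar> * \<rho> x" for t x
    by (simp add: \<rho>_def matrix_vector_mult_scaleR real_sqrt_mult flip: mult.assoc)
  have \<rho>_P: "\<rho> (P *v y) = norm y" for y
    by (simp add: \<rho>_def quadratic_form_congruent_one[OF P] norm_eq_sqrt_inner)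
  have f_nonneg: "0 \<le> f z" for z using \<rho>_nonneg by (simp add: f_def N_def)
  have [measurable]: "(\<lambda>x. M *v x) \<in> borel_measurable borel" for M :: "real^'n^'n"
    by (intro borel_measurable_continuous_onI linear_continuous_on)
      (simp add: linear_linear)
  have [measurable]: "\<rho> \<in> borel_measurable borel" unfolding \<rho>_def by measurable
  have f_meas[measurable]: "f \<in> borel_measurable borel" unfolding f_def by measurable
  have g_meas[measurable]: "g \<in> borel_measurable borel"
    by (rule borel_measurable_continuous_onI[OF form_continuous[OF g]])
  have sgn_meas[measurable]: "sgn \<in> borel_measurable (borel :: (real^'n) measure)"
    unfolding sgn_div_norm by measurable
  have sphere: "h \<in> borel_measurable sphere_measure" if "h \<in> borel_measurable borel"
    for h :: "real^'n \<Rightarrow> 'b::topological_space"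
    using that by (subst measurable_cong_sets[OF sets_sphere_measure refl]) (simp add: measurable_restrict_space1)
  have w_meas: "(\<lambda>z. ennreal (sqrt (Determinants.det Q) / sqrt (z \<bullet> (Q *v z)) ^ ?n /
      measure sphere_measure (sphere (0 :: real^'n) 1))) \<in> borel_measurable sphere_measure"
    unfolding \<rho>_def[symmetric] by (rule sphere) measurable
  \<comment> \<open>The outer density \<open>f\<close> carries the power \<open>d\<close> and the
    constant \<open>N\<close>; the inner one is the weight treated in
    \<open>distr_density_sphere_measure\<close>.\<close>
  have nu: "nu d Q = density ?W (\<lambda>z. ennreal (f z))"
  proof (subst density_density_eq[OF w_meas])
    show "(\<lambda>z. ennreal (f z)) \<in> borel_measurable sphere_measure" by (rule sphere) measurable
    show "nu d Q = density sphere_measure (\<lambda>z. ennreal (sqrt (Determinants.det Q) / sqrt (z \<bullet> (Q *v z)) ^ ?n /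
      measure sphere_measure (sphere (0 :: real^'n) 1)) * ennreal (f z))"
      unfolding nu_def \<rho>_def[symmetric] f_def N_def[symmetric]
      using f_nonneg
      by (intro arg_cong[where f = "density sphere_measure"] ext, subst ennreal_mult''[symmetric])
        (simp_all add: f_def power_add mult_ac)
  qed
  have "moment_functional d Q g = (LINT z|?W. f z * g z)"
    unfolding moment_functional_def nu
    by (subst integral_density) (auto simp: f_nonneg intro!: sphere)
  also have "\<dots> = (LINT z|distr ?W borel id. f z * g z)"
    by (subst integral_distr) (auto intro!: sphere)
  also have "\<dots> = (LINT z|distr ?U borel (\<lambda>y. sgn (P *v y)). f z * g z)"
    by (simp only: distr_density_sphere_measure[OF Q P])
  also have "\<dots> = (LINT y|?U. f (sgn (P *v y)) * g (sgn (P *v y)))"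
    by (subst integral_distr) auto
  also have "\<dots> = (LINT y|?U. N * g (P *v sgn y))"
  proof (rule Bochner_Integration.integral_cong[OF refl])
    fix y :: "real^'n"
    show "f (sgn (P *v y)) * g (sgn (P *v y)) = N * g (P *v sgn y)"
    proof (cases "y = 0")
      case True
      \<comment> \<open>Since \<open>d > 0\<close>, the form vanishes at \<open>sgn 0 = 0\<close>,
        which makes both sides 0 whatever the value of \<open>f 0\<close>.\<close>
      have "g 0 = 0" using g d by (rule form_zero)
      then show ?thesis by (simp add: True)
    next
      case False
      then have Py: "P *v y \<noteq> 0" using \<rho>_P[of y] \<rho>_P[of 0] by auto
      have "f (sgn (P *v y)) = N * (norm (P *v y) / norm y) ^ d"
        using Py False by (simp add: f_def sgn_div_norm \<rho>_scale \<rho>_P power_mult_distrib power_divide field_simps)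
      moreover have "g (sgn (P *v y)) = g (P *v y) / norm (P *v y) ^ d"
        "g (P *v sgn y) = g (P *v y) / norm y ^ d"
        by (simp_all add: sgn_div_norm matrix_vector_mult_scaleR form_scaleR[OF g] power_divide divide_inverse power_inverse)
      ultimately show ?thesis using Py False by (simp add: power_divide)
    qed
  qed
  also have "\<dots> = N * sphere_mean (\<lambda>x. g (P *v x))" by (simp add: sphere_mean_def)
  finally show ?thesis by (simp add: N_def)
qed

section \<open>Reproducing kernels\<close>

text \<open>
  Locale assumptions are monomorphic, so linearity is stated for the one index type that products
  of pairs of monomials need.
\<close>

locale positive_form_functional =
  fixes k :: nat and es :: "('n::finite \<Rightarrow> nat) list" and L :: "(real^'n \<Rightarrow> real) \<Rightarrow> real"
  assumes es: "exponent_order k es"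
    and L_sum: "\<And>(I :: (nat \<times> nat) set) c f. finite I \<Longrightarrow> (\<And>p. p \<in> I \<Longrightarrow> form (2 * k) (f p)) \<Longrightarrow>
      L (\<lambda>x. \<Sum>p\<in>I. c p * f p x) = (\<Sum>p\<in>I. c p * L (f p))"
    and L_pos: "\<And>f x. form k f \<Longrightarrow> f x \<noteq> 0 \<Longrightarrow> 0 < L (\<lambda>x. (f x)\<^sup>2)"
begin

abbreviation "M \<equiv> moment_mat es L"
abbreviation "N \<equiv> length es"
abbreviation "m i \<equiv> monomial (es ! i)"

lemma bij_betw_es: "bij_betw ((!) es) {..<N} (exponents k)"
  using es bij_betw_nth[of es "{..<N}" "exponents k"] by (simp add: exponent_order_def)

lemma es_nth: "i < N \<Longrightarrow> es ! i \<in> exponents k"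
  using es nth_mem[of i es] by (simp add: exponent_order_def)

lemma form_m: "i < N \<Longrightarrow> form k (m i)"
  by (intro form_monomial es_nth)

lemma form_m_mult: "i < N \<Longrightarrow> j < N \<Longrightarrow> form (2 * k) (\<lambda>x. m i x * m j x)"
  using form_mult[OF form_m form_m] by (simp add: mult_2)

lemma form_eq_sum_m:
  assumes "form k f"
  obtains c where "f = (\<lambda>x. \<Sum>i<N. c i * m i x)"
proof -
  obtain c where c: "f = (\<lambda>x. \<Sum>\<alpha>\<in>exponents k. c \<alpha> * monomial \<alpha> x)" using form_expand[OF assms] .
  from sum.reindex_bij_betw[OF bij_betw_es, of "\<lambda>\<alpha>. c \<alpha> * monomial \<alpha> _"]
  have "f = (\<lambda>x. \<Sum>i<N. c (es ! i) * m i x)" by (simp add: c)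
  then show ?thesis by (rule that)
qed

lemma m_independent:
  assumes "\<And>x. (\<Sum>i<N. c i * m i x) = 0" and "i < N"
  shows "c i = 0"
proof -
  define b where "b \<alpha> = c (the_inv_into {..<N} ((!) es) \<alpha>)" for \<alpha>
  have b: "b (es ! j) = c j" if "j < N" for j
    using bij_betw_es that by (simp add: b_def bij_betw_def the_inv_into_f_f)
  have b_sum: "(\<Sum>\<alpha>\<in>exponents k. b \<alpha> * monomial \<alpha> x) = 0" for x
    using sum.reindex_bij_betw[OF bij_betw_es, of "\<lambda>\<alpha>. b \<alpha> * monomial \<alpha> x"] assms(1)[of x] by (simp add: b)
  show ?thesis
    using monomials_independent[where c = b, OF b_sum es_nth[OF assms(2)]] by (simp add: b[OF assms(2)])
qed

lemma L_sum_m_mult: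
  "L (\<lambda>x. \<Sum>i<N. \<Sum>j<N. c i j * (m i x * m j x)) = (\<Sum>i<N. \<Sum>j<N. c i j * L (\<lambda>x. m i x * m j x))"
  using L_sum[of "{..<N} \<times> {..<N}" "\<lambda>(i, j) x. m i x * m j x" "\<lambda>(i, j). c i j"]
  by (auto simp: form_m_mult sum.cartesian_product case_prod_beta)

lemma M_carrier: "M \<in> carrier_mat N N"
  by (simp add: moment_mat_def)

lemma M_entry: "i < N \<Longrightarrow> j < N \<Longrightarrow> M $$ (i, j) = L (\<lambda>x. m i x * m j x)"
  by (simp add: moment_mat_def monomial_add[abs_def])

lemma M_transpose: "transpose_mat M = M"
  by (rule eq_matI) (simp_all add: moment_mat_def add.commute)

lemma M_quadratic_form:
  assumes "v \<in> carrier_vec N"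
  shows "scalar_prod v (mult_mat_vec M v) = L (\<lambda>x. (\<Sum>i<N. vec_index v i * m i x)\<^sup>2)"
proof -
  have "(\<lambda>x. (\<Sum>i<N. vec_index v i * m i x)\<^sup>2) =
      (\<lambda>x. \<Sum>i<N. \<Sum>j<N. (vec_index v i * vec_index v j) * (m i x * m j x))"
    by (simp add: power2_eq_square sum_product mult_ac)
  then have "L (\<lambda>x. (\<Sum>i<N. vec_index v i * m i x)\<^sup>2) =
      (\<Sum>i<N. \<Sum>j<N. (vec_index v i * vec_index v j) * L (\<lambda>x. m i x * m j x))"
    by (simp only: L_sum_m_mult)
  also have "\<dots> = scalar_prod v (mult_mat_vec M v)"
    using assms M_carrier
    by (simp add: scalar_prod_def mult_mat_vec_def M_entry sum_distrib_left lessThan_atLeast0 mult_ac)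
  finally show ?thesis ..
qed

text \<open>By independence of the monomials, a nonzero vector is the coefficient vector of a
  nonzero form, and \<open>L\<close> is positive on its square.\<close>

lemma M_pos:
  assumes v: "v \<in> carrier_vec N" "v \<noteq> 0\<^sub>v N"
  shows "0 < scalar_prod v (mult_mat_vec M v)"
proof -
  obtain i where "i < N" "vec_index v i \<noteq> 0" using v by (metis carrier_vecD eq_vecI index_zero_vec)
  then obtain x where "(\<Sum>i<N. vec_index v i * m i x) \<noteq> 0" using m_independent[of "vec_index v" i] by blast
  moreover have "form k (\<lambda>x. \<Sum>i<N. vec_index v i * m i x)" by (rule form_sum) (simp add: form_m)
  ultimately show ?thesis unfolding M_quadratic_form[OF v(1)] by (intro L_pos)
qed

lemma M_inverse:
  obtains G where "G \<in> carrier_mat N N" "M * G = 1\<^sub>m N" "G * M = 1\<^sub>m N"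
proof -
  have "Determinant.det M \<noteq> 0"
  proof
    assume "Determinant.det M = 0"
    then obtain v where v: "v \<in> carrier_vec N" "v \<noteq> 0\<^sub>v N" "mult_mat_vec M v = 0\<^sub>v N"
      using det_0_iff_vec_prod_zero[OF M_carrier] by blast
    with M_pos[OF v(1,2)] show False by simp
  qed
  from det_non_zero_imp_unit[OF M_carrier this, of "()"] show ?thesis
    using that by (auto simp: Units_def ring_mat_def)
qed

end

section \<open>The kernel given by the inverse moment matrix\<close>

locale inverse_moment_mat = positive_form_functional k es L
  for k and es :: "('n::finite \<Rightarrow> nat) list" and L +
  fixes G :: "real Matrix.mat"
  assumes G: "G \<in> carrier_mat N N" "M * G = 1\<^sub>m N" "G * M = 1\<^sub>m N"
begin

text \<open>The bilinear expression m(x)^T G m(y), grouped so that for fixed \<open>x\<close> it is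
  visibly a linear combination of monomials in \<open>y\<close>.\<close>

definition kernel :: "real^'n \<Rightarrow> real^'n \<Rightarrow> real" where
  "kernel x y = (\<Sum>j<N. (\<Sum>i<N. m i x * G $$ (i, j)) * m j y)"

lemma G_M: "i < N \<Longrightarrow> j < N \<Longrightarrow> (\<Sum>l<N. G $$ (i, l) * L (\<lambda>x. m l x * m j x)) = (if i = j then 1 else 0)"
proof -
  assume ij: "i < N" "j < N"
  have "(G * M) $$ (i, j) = (\<Sum>l<N. G $$ (i, l) * M $$ (l, j))"
    using ij G(1) M_carrier by (simp add: scalar_prod_def lessThan_atLeast0)
  then show ?thesis using ij by (simp add: G(3) M_entry)
qed

lemma kernel_diag: "kernel x x = scalar_prod (monomial_vec es x) (mult_mat_vec G (monomial_vec es x))"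
  using G(1) unfolding kernel_def
  by (subst sum_distrib_right, subst sum.swap)
    (simp add: monomial_vec_def scalar_prod_def mult_mat_vec_def sum_distrib_left lessThan_atLeast0 mult_ac)

lemma form_kernel: "form k (kernel x)"
  unfolding kernel_def[abs_def] by (rule form_sum) (simp add: form_m)

lemma kernel_scaleR: "kernel (t *\<^sub>R x) (t *\<^sub>R x) = t ^ (2 * k) * kernel x x"
proof -
  have "kernel (t *\<^sub>R x) (t *\<^sub>R x) =
      (\<Sum>j<N. \<Sum>i<N. (t ^ k * t ^ k) * (m i x * G $$ (i, j) * m j x))"
    unfolding kernel_def sum_distrib_right
    by (intro sum.cong refl) (simp add: form_scaleR[OF form_m])
  also have "t ^ k * t ^ k = t ^ (2 * k)" by (simp add: mult_2 power_add)
  finally show ?thesis by (simp only: kernel_def sum_distrib_left sum_distrib_right)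
qed

text \<open>The form \<open>kernel x\<close> has the coefficient vector m(x)^T G. Pairing it under
  \<open>L\<close> with all monomials gives m(x)^T G M = m(x)^T, the values of the monomials at
  \<open>x\<close>; the rest is linearity.\<close>

lemma kernel_reproducing:
  assumes "form k f"
  shows "L (\<lambda>y. kernel x y * f y) = f x"
proof -
  obtain c where c: "f = (\<lambda>x. \<Sum>i<N. c i * m i x)" using form_eq_sum_m[OF assms] .
  define b where "b j = (\<Sum>i<N. m i x * G $$ (i, j))" for j
  have "(\<lambda>y. kernel x y * f y) = (\<lambda>y. \<Sum>l<N. \<Sum>j<N. (b l * c j) * (m l y * m j y))"
    by (simp add: kernel_def c b_def[symmetric] sum_product mult_ac)
  then have "L (\<lambda>y. kernel x y * f y) = (\<Sum>l<N. \<Sum>j<N. (b l * c j) * L (\<lambda>x. m l x * m j x))"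
    by (simp only: L_sum_m_mult)
  also have "\<dots> = (\<Sum>j<N. c j * (\<Sum>l<N. b l * L (\<lambda>x. m l x * m j x)))"
    by (subst sum.swap) (simp add: sum_distrib_left mult_ac)
  also have "\<dots> = (\<Sum>j<N. c j * m j x)"
  proof (intro sum.cong refl arg_cong2[where f = "(*)"])
    fix j assume j: "j \<in> {..<N}"
    have "(\<Sum>l<N. b l * L (\<lambda>x. m l x * m j x)) = (\<Sum>l<N. \<Sum>i<N. m i x * (G $$ (i, l) * L (\<lambda>x. m l x * m j x)))"
      by (simp only: b_def sum_distrib_right mult.assoc)
    also have "\<dots> = (\<Sum>i<N. m i x * (\<Sum>l<N. G $$ (i, l) * L (\<lambda>x. m l x * m j x)))"
      by (subst sum.swap) (simp add: sum_distrib_left)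
    also have "\<dots> = (\<Sum>i<N. if i = j then m j x else 0)"
      using j by (intro sum.cong refl) (simp add: G_M)
    also have "\<dots> = m j x" using j by simp
    finally show "(\<Sum>l<N. b l * L (\<lambda>x. m l x * m j x)) = m j x" .
  qed
  finally show ?thesis by (simp add: c)
qed

lemma kernel_trace: "L (\<lambda>x. kernel x x) = real N"
proof -
  have "(\<lambda>x. kernel x x) = (\<lambda>x. \<Sum>j<N. \<Sum>i<N. G $$ (i, j) * (m j x * m i x))"
    unfolding kernel_def sum_distrib_right by (intro ext sum.cong refl) (simp add: mult_ac)
  then have "L (\<lambda>x. kernel x x) = (\<Sum>j<N. \<Sum>i<N. G $$ (i, j) * L (\<lambda>x. m j x * m i x))"
    by (simp only: L_sum_m_mult)
  also have "\<dots> = (\<Sum>i<N. \<Sum>j<N. G $$ (i, j) * L (\<lambda>x. m j x * m i x))" by (rule sum.swap)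
  also have "\<dots> = real N" by (simp add: G_M)
  finally show ?thesis .
qed

text \<open>Both \<open>kernel x\<close> and \<open>\<lambda>y. kernel (A x) (A y)\<close> represent evaluation at \<open>x\<close>.\<close>

lemma kernel_invariant:
  fixes A A' :: "real^'n^'n"
  assumes "\<And>x. A *v (A' *v x) = x" "\<And>x. A' *v (A *v x) = x"
    and inv: "\<And>f. form (2 * k) f \<Longrightarrow> L (\<lambda>x. f (A *v x)) = L f"
  shows "kernel (A *v x) (A *v x) = kernel x x"
proof -
  define h where "h y = kernel (A *v x) (A *v y)" for y
  have h: "form k h" unfolding h_def by (rule form_compose_matrix) (rule form_kernel)
  have rep: "L (\<lambda>y. h y * f y) = f x" if f: "form k f" for f
  proof -
    have f': "form k (\<lambda>y. f (A' *v y))" by (rule form_compose_matrix[OF f])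
    \<comment> \<open>The integrand on the right, composed with \<open>A\<close>, is
      \<open>h y * f y\<close>, because \<open>A'\<close> undoes \<open>A\<close> inside
      \<open>f\<close>.\<close>
    have "L (\<lambda>y. h y * f y) = L (\<lambda>y. kernel (A *v x) y * f (A' *v y))"
      using inv[of "\<lambda>y. kernel (A *v x) y * f (A' *v y)"] form_mult[OF form_kernel f']
      by (simp add: h_def assms mult_2)
    also have "\<dots> = f x" using kernel_reproducing[OF f'] by (simp add: assms)
    finally show ?thesis .
  qed
  \<comment> \<open>The two representers are paired with each other: \<open>rep\<close> evaluates
    \<open>kernel x\<close> at \<open>x\<close>, the reproducing property evaluates \<open>h\<close>
    at \<open>x\<close>.\<close>
  have "kernel x x = L (\<lambda>y. kernel x y * h y)" using rep[OF form_kernel, of x] by (simp add: mult.commute)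
  also have "\<dots> = h x" by (rule kernel_reproducing[OF h])
  finally show ?thesis by (simp add: h_def)
qed

text \<open>The transpose of \<open>G\<close> is another inverse of the symmetric \<open>M\<close>,
  so it equals \<open>G\<close>. For positivity put w = G v; then v = M w and v^T G v = w^T M
  w.\<close>

lemma psd_G: "psd_mat N G"
  unfolding psd_mat_def
proof (intro conjI ballI)
  show "G \<in> carrier_mat N N" by (rule G(1))
  have Gt: "transpose_mat G \<in> carrier_mat N N" using G(1) by simp
  have "M * transpose_mat G = transpose_mat (G * M)"
    using G(1) M_carrier by (simp add: transpose_mult M_transpose)
  then have MGt: "M * transpose_mat G = 1\<^sub>m N" by (simp add: G(3))
  have "transpose_mat G = (G * M) * transpose_mat G" using Gt by (simp add: G(3))
  also have "\<dots> = G * (M * transpose_mat G)" using G(1) M_carrier Gt by simp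
  also have "\<dots> = G" using G(1) by (simp add: MGt)
  finally show "transpose_mat G = G" .
  fix v :: "real Matrix.vec" assume v: "v \<in> carrier_vec N"
  define w where "w = mult_mat_vec G v"
  have w: "w \<in> carrier_vec N" using G(1) v by (simp add: w_def)
  have Mw: "mult_mat_vec M w = v"
    unfolding w_def using assoc_mult_mat_vec[OF M_carrier G(1) v] v by (simp add: G(2))
  have "0 \<le> scalar_prod w (mult_mat_vec M w)"
  proof (cases "w = 0\<^sub>v N")
    case True
    then show ?thesis using M_carrier by simp
  qed (use M_pos[OF w] in simp)
  also have "\<dots> = scalar_prod v w" unfolding Mw by (rule comm_scalar_prod[OF w v])
  finally show "0 \<le> scalar_prod v (mult_mat_vec G v)" by (simp add: w_def)
qed

end

text \<open>\<open>P'\<close> inverts \<open>P\<close>, so x^T Q x is the sum of the squares of the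
  coordinates of P' x, which are linear forms.\<close>

lemma sos_form_quadratic_power:
  fixes P P' Q :: "real^'n^'n"
  assumes "Finite_Cartesian_Product.transpose P ** Q ** P = Finite_Cartesian_Product.mat 1"
    and "\<And>x. P *v (P' *v x) = x"
  shows "sos_form (2 * k) (\<lambda>x. (x \<bullet> (Q *v x)) ^ k)"
proof -
  have "x \<bullet> (Q *v x) = (\<Sum>i\<in>UNIV. ((P' *v x) $ i)\<^sup>2)" for x
    using quadratic_form_congruent_one[OF assms(1), of "P' *v x" "P' *v x"]
    by (simp add: assms(2) inner_vec_def power2_eq_square)
  then show ?thesis
    using sos_form_power_sum_squares[of UNIV "\<lambda>i x. (P' *v x) $ i" k, OF finite form_matrix_component]
    by simp
qed

section \<open>The kernel on the diagonal as a power of the quadratic form\<close>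

theorem corollary1p8:
  fixes Q :: "real ^ 'n ^ 'n" and d :: nat and es :: "('n \<Rightarrow> nat) list"
  assumes "d \<ge> 2" and "even d"
    and "pos_def Q"
    and "exponent_order (d div 2) es"
  shows "\<exists>G. inverts_mat (moment_mat es (moment_functional d Q)) G \<and>
             inverts_mat G (moment_mat es (moment_functional d Q)) \<and>
             gram_mat d es (\<lambda>x. (x \<bullet> (Q *v x)) ^ (d div 2)) G"
proof -
  define k where "k = d div 2"
  have d: "d = 2 * k" and k: "0 < k" using assms(1,2) by (auto simp: k_def)
  define L where "L = moment_functional d Q"
  define q where "q x = x \<bullet> (Q *v x)" for x
  define c where "c = real ((k + CARD('n) - 1) choose (CARD('n) - 1))"
  have c: "c > 0" by (simp add: c_def)
  have card_es: "real (length es) = c"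
    using assms(4) distinct_card[of es] card_exponents[of k, where 'n = 'n]
    by (simp add: exponent_order_def c_def k_def)
  obtain P :: "real^'n^'n" where P: "Finite_Cartesian_Product.transpose P ** Q ** P = Finite_Cartesian_Product.mat 1"
    using pos_def_congruent_one[OF assms(3)] .
  have "inj ((*v) P)" using congruent_one_surj[OF P] by (simp add: linear_surjective_imp_injective)
  then have "invertible P" using invertible_left_inverse matrix_left_invertible_injective by blast
  then obtain P' where "P ** P' = Finite_Cartesian_Product.mat 1" "P' ** P = Finite_Cartesian_Product.mat 1"
    unfolding invertible_def by blast
  then have PP': "P *v (P' *v x) = x" and P'P: "P' *v (P *v x) = x" for x
    by (simp_all add: matrix_vector_mul_assoc)
  have q_P: "q (P *v x) = (norm x)\<^sup>2" for x
    using quadratic_form_congruent_one[OF P, of x x] by (simp add: q_def power2_norm_eq_inner)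
  have sos: "sos_form d (\<lambda>x. q x ^ k)"
    using sos_form_quadratic_power[OF P PP'] by (simp add: q_def d)
  then have form_q: "form d (\<lambda>x. q x ^ k)" by (simp add: sos_form_def)
  have L_eq: "L f = c * sphere_mean (\<lambda>x. f (R *v x))"
    if "form d f" "Finite_Cartesian_Product.transpose R ** Q ** R = Finite_Cartesian_Product.mat 1"
    for f and R :: "real^'n^'n"
    using moment_functional_eq_sphere_mean[OF assms(3) that(2) _ that(1)] d k by (simp add: L_def c_def)
  have cont: "continuous_on UNIV (\<lambda>x. f (P *v x))" if "form j f" for f :: "real^'n \<Rightarrow> real" and j
    by (rule form_continuous[OF form_compose_matrix[OF that]])
  interpret positive_form_functional k es L
  proof
    show "exponent_order k es" using assms(4) by (simp add: k_def)
  next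
    fix I :: "(nat \<times> nat) set" and b :: "nat \<times> nat \<Rightarrow> real" and f :: "nat \<times> nat \<Rightarrow> real^'n \<Rightarrow> real"
    assume I: "finite I" "\<And>p. p \<in> I \<Longrightarrow> form (2 * k) (f p)"
    have "L (\<lambda>x. \<Sum>p\<in>I. b p * f p x) = c * sphere_mean (\<lambda>x. \<Sum>p\<in>I. b p * f p (P *v x))"
      using form_sum[of I d f b] I(2) by (intro L_eq P) (simp add: d)
    also have "\<dots> = (\<Sum>p\<in>I. b p * (c * sphere_mean (\<lambda>x. f p (P *v x))))"
      using cont[OF I(2)] by (subst sphere_mean_sum) (auto simp: sum_distrib_left mult.left_commute)
    also have "\<dots> = (\<Sum>p\<in>I. b p * L (f p))"
      using I(2) by (intro sum.cong refl) (simp add: L_eq[OF _ P] d)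
    finally show "L (\<lambda>x. \<Sum>p\<in>I. b p * f p x) = (\<Sum>p\<in>I. b p * L (f p))" .
  next
    fix f :: "real^'n \<Rightarrow> real" and x
    assume f: "form k f" and x: "f x \<noteq> 0"
    let ?y = "P' *v x"
    \<comment> \<open>A form of degree \<open>k > 0\<close> vanishes at 0, so \<open>x\<close>, and
      with it P' x, is nonzero and can be normalised to a point of the sphere.\<close>
    have y: "?y \<noteq> 0" using x form_zero[OF f k] PP'[of x] by auto
    have "form d (\<lambda>x. (f x)\<^sup>2)" using form_power[OF f, of 2] by (simp add: d)
    moreover have "0 < sphere_mean (\<lambda>x. (f (P *v x))\<^sup>2)"
    proof (rule sphere_mean_pos)
      show "continuous_on UNIV (\<lambda>x. (f (P *v x))\<^sup>2)" by (intro continuous_intros cont[OF f])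
      show "norm (sgn ?y) = 1" using y by (simp add: norm_sgn)
      show "(f (P *v sgn ?y))\<^sup>2 \<noteq> 0"
        using x y by (simp add: sgn_div_norm matrix_vector_mult_scaleR form_scaleR[OF f] PP')
    qed simp
    ultimately show "0 < L (\<lambda>x. (f x)\<^sup>2)" using c by (simp add: L_eq[OF _ P])
  qed
  obtain G where G: "G \<in> carrier_mat N N" "M * G = 1\<^sub>m N" "G * M = 1\<^sub>m N" using M_inverse .
  interpret inverse_moment_mat k es L G by unfold_locales (fact G)+
  have rotation: "kernel (P *v x) (P *v x) = kernel (P *v y) (P *v y)" if norm_eq: "norm x = norm y" for x y
  proof -
    obtain f where f: "orthogonal_transformation f" "f x = y" using orthogonal_transformation_exists[OF norm_eq] .
    define U where "U = matrix f"
    have U: "U *v x = y" "orthogonal_matrix U"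
      using f orthogonal_transformation_matrix[of f] by (simp_all add: U_def orthogonal_transformation_linear)
    \<comment> \<open>The rotation \<open>U\<close> in the coordinates in which Q becomes the
      identity; it carries P x to P y, and \<open>?A'\<close> is its inverse because the transpose
      inverts \<open>U\<close>.\<close>
    let ?A = "P ** U ** P'" and ?A' = "P ** Finite_Cartesian_Product.transpose U ** P'"
    have U': "U *v (Finite_Cartesian_Product.transpose U *v z) = z"
        "Finite_Cartesian_Product.transpose U *v (U *v z) = z" for z
      using U(2) by (simp_all add: orthogonal_matrix_def matrix_vector_mul_assoc del: transpose_matrix_vector)
    have A: "?A *v z = P *v (U *v (P' *v z))" "?A' *v z = P *v (Finite_Cartesian_Product.transpose U *v (P' *v z))" for z
      by (simp_all only: matrix_vector_mul_assoc matrix_mul_assoc)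
    have "Finite_Cartesian_Product.transpose (P ** U) ** Q ** (P ** U) =
        Finite_Cartesian_Product.transpose U ** (Finite_Cartesian_Product.transpose P ** Q ** P) ** U"
      by (simp add: matrix_transpose_mul matrix_mul_assoc)
    then have PU: "Finite_Cartesian_Product.transpose (P ** U) ** Q ** (P ** U) = Finite_Cartesian_Product.mat 1"
      using U(2) by (simp add: P orthogonal_matrix_def)
    have "kernel (?A *v (P *v x)) (?A *v (P *v x)) = kernel (P *v x) (P *v x)"
    proof (rule kernel_invariant)
      show "?A *v (?A' *v z) = z" "?A' *v (?A *v z) = z" for z
        by (simp_all only: A P'P PP' U')
      fix f :: "real^'n \<Rightarrow> real" assume "form (2 * k) f"
      then have f: "form d f" by (simp add: d)
      have "L (\<lambda>x. f (?A *v x)) = c * sphere_mean (\<lambda>x. f (?A *v (P *v x)))"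
        by (rule L_eq[OF form_compose_matrix[OF f] P])
      also have "\<dots> = c * sphere_mean (\<lambda>x. f ((P ** U) *v x))"
        by (simp only: A P'P matrix_vector_mul_assoc[symmetric])
      also have "\<dots> = L f" by (rule L_eq[OF f PU, symmetric])
      finally show "L (\<lambda>x. f (?A *v x)) = L f" .
    qed
    then show ?thesis by (simp only: A P'P U(1))
  qed
  \<comment> \<open>Any index serves: \<open>axis i 1\<close> is just some unit vector, which makes
    \<open>e\<close> a reference point with q = 1.\<close>
  obtain i :: 'n where True by simp
  define e where "e = P *v axis i 1"
  have kernel_e: "kernel x x = kernel e e * q x ^ k" for x
  proof (cases "x = 0")
    case True
    then show ?thesis using kernel_scaleR[of 0 0] k by (simp add: q_def zero_power)
  next
    case False
    \<comment> \<open>This is sqrt(q x), as q (P z) = (norm z)^2 with z = P' x; hence x /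
      \<open>?r\<close> lies on q = 1, where the kernel has the value
      \<open>kernel e e\<close>.\<close>
    let ?r = "norm (P' *v x)"
    have r: "?r \<noteq> 0" using False PP'[of x] by auto
    have "kernel x x = kernel (?r *\<^sub>R (P *v sgn (P' *v x))) (?r *\<^sub>R (P *v sgn (P' *v x)))"
      using r by (simp add: sgn_div_norm matrix_vector_mult_scaleR PP')
    also have "\<dots> = ?r ^ d * kernel (P *v sgn (P' *v x)) (P *v sgn (P' *v x))" unfolding d by (rule kernel_scaleR)
    also have "kernel (P *v sgn (P' *v x)) (P *v sgn (P' *v x)) = kernel e e"
      unfolding e_def using r by (intro rotation) (simp add: norm_sgn)
    also have "?r ^ d = q x ^ k" using q_P[of "P' *v x"] by (simp add: PP' d power_mult)
    finally show ?thesis by (simp add: mult.commute)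
  qed
  have "(\<lambda>x. kernel x x) = (\<lambda>x. kernel e e * q x ^ k)" by (rule ext) (rule kernel_e)
  with kernel_trace have "real N = L (\<lambda>x. kernel e e * q x ^ k)" by (simp only:)
  \<comment> \<open>After the substitution x = P y the power of q becomes a power of norm y, which
    is 1 on the sphere, so the mean is that of a constant.\<close>
  also have "\<dots> = c * sphere_mean (\<lambda>x :: real^'n. kernel e e * ((norm x)\<^sup>2) ^ k)"
    by (simp add: L_eq[OF form_cmult[OF form_q] P] q_P)
  also have "\<dots> = c * kernel e e"
  proof -
    have "sphere_mean (\<lambda>x :: real^'n. kernel e e * ((norm x)\<^sup>2) ^ k) = kernel e e"
      by (rule sphere_mean_const) (auto intro!: continuous_intros)
    then show ?thesis by simp
  qed
  finally have "kernel e e = 1" using c card_es by simp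
  then have "q x ^ k = kernel x x" for x using kernel_e[of x] by simp
  then have "gram_mat d es (\<lambda>x. q x ^ k) G"
    unfolding gram_mat_def using sos psd_G kernel_diag by metis
  moreover have "inverts_mat M G" "inverts_mat G M"
    using G M_carrier by (simp_all add: inverts_mat_def)
  ultimately show ?thesis unfolding q_def k_def[symmetric] L_def by blast
qed

end
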